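(* Let $X$ be a finite cellular poset with a homologically admissible Morse matching $M$ on its Hasse diagram. Then the (unreduced, integral) homology of $X$ can be computed with a chain complex $(\tilde C_*,\tilde d)$, where $\tilde C_p$ is the free abelian group generated by the critical points of $X$ of degree $p$; that is, there are homomorphisms $\tilde d:\tilde C_p\to\tilde C_{p-1}$ with $\tilde d^2=0$ such that $H_p(\tilde C_*,\tilde d)\cong H_p(\mathcal{K}(X);\mathbb{Z})$ for all $p\ge 0$. In particular, the strong Morse inequalities (and hence the weak Morse inequalities) hold: writing $m_p$ for the number of critical points of degree $p$ and $b_p$ for the rank of $H_p(\mathcal{K}(X);\mathbb{Z})$, for every $k\ge 0$ $$m_k-m_{k-1}+\dots+(-1)^k m_0\ \ge\ b_k-b_{k-1}+\dots+(-1)^k b_0,$$ and hence $m_p\ge b_p$ for all $p$ and $\sum_p(-1)^p m_p=\sum_p(-1)^p b_p$.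
   Context: All posets are finite. For a poset $X$ and $x\in X$, $\hat U_x=\{y\in X: y<x\}$ and $U_x=\{y\in X: y\le x\}$. The order complex $\mathcal{K}(X)$ is the simplicial complex of non-empty chains of $X$, and the homology of $X$ means the homology of $\mathcal{K}(X)$. The chain $x_0<\dots<x_n$ has length $n$; a poset is homogeneous if all its maximal chains have the same length; $X$ is graded if $U_x$ is homogeneous for every $x\in X$, and then the degree $\deg(x)$ is the maximum length of a chain in $U_x$. A cellular poset is a graded poset $X$ such that for every $x\in X$, $\hat U_x$ has the reduced integral homology of a $(p-1)$-sphere, where $p=\deg(x)$ (with $S^{-1}=\emptyset$). Write $x\prec y$ if $x<y$ and there is no $z$ with $x<z<y$. The Hasse diagram $\mathcal{H}(X)$ is the directed graph with vertex set $X$ and edges the pairs $(x,y)$ with $x\prec y$. An edge $(w,x)$ is homologically admissible if $\hat U_x\setminus\{w\}$ is acyclic (all reduced integral homology groups vanish). A matching $M$ is a set of edges no two of which share a vertex. $\mathcal{H}_M(X)$ is obtained from $\mathcal{H}(X)$ by reversing the orientation of the edges not in $M$. $M$ is a Morse matching if $\mathcal{H}_M(X)$ has no directed cycles, and it is homologically admissible if all its edges are. Critical points are the elements of $X$ not incident to any edge of $M$. *)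

theory Defs
  imports "HOL-Algebra.Free_Abelian_Groups"
begin

text \<open>
  Chain complexes and homology are indexed by integers, so that reduced homology has its
  group in dimension -1 and so that no special case is needed for the boundary in dimension 0.
\<close>

definition chain_complex ::
    "(int \<Rightarrow> ('c, 'm) monoid_scheme) \<Rightarrow> (int \<Rightarrow> 'c \<Rightarrow> 'c) \<Rightarrow> bool" where
  "chain_complex C d \<longleftrightarrow>
     (\<forall>p. comm_group (C p)) \<and>
     (\<forall>p. d p \<in> hom (C p) (C (p - 1))) \<and>
     (\<forall>p. \<forall>c\<in>carrier (C p). d (p - 1) (d p c) = \<one>\<^bsub>C (p - 2)\<^esub>)"

definition chain_homology ::
    "(int \<Rightarrow> ('c, 'm) monoid_scheme) \<Rightarrow> (int \<Rightarrow> 'c \<Rightarrow> 'c) \<Rightarrow> int \<Rightarrow> 'c set monoid" where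
  "chain_homology C d p =
     subgroup_generated (C p) (kernel (C p) (C (p - 1)) (d p)) Mod (d (p + 1) ` carrier (C (p + 1)))"

text \<open>
  Simplicial homology of a set \<open>K\<close> of finite simplices, each of which is linearly ordered by \<open>r\<close>;
  this order fixes the orientations. The simplex \<open>v\<^sub>0 < \<dots> < v\<^sub>p\<close> has boundary
  \<open>\<Sum>\<^sub>i (-1)\<^sup>i (s - {v\<^sub>i})\<close>, and \<open>i\<close> is the number of vertices strictly below \<open>v\<^sub>i\<close>.
  Only faces in \<open>K\<close> are kept: if \<open>K\<close> does not contain the empty simplex, then vertices have zero
  boundary (unreduced homology), and if it does, then the boundary of a vertex is the empty
  simplex, of dimension -1 (augmented complex, reduced homology).
\<close>

definition simplicial_chain_group :: "'a set set \<Rightarrow> int \<Rightarrow> ('a set \<Rightarrow>\<^sub>0 int) monoid" where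
  "simplicial_chain_group K p = free_Abelian_group {s \<in> K. int (card s) = p + 1}"

definition simplicial_boundary ::
    "'a rel \<Rightarrow> 'a set set \<Rightarrow> ('a set \<Rightarrow>\<^sub>0 int) \<Rightarrow> ('a set \<Rightarrow>\<^sub>0 int)" where
  "simplicial_boundary r K =
     frag_extend (\<lambda>s. \<Sum>v | v \<in> s \<and> s - {v} \<in> K.
       frag_cmul ((-1) ^ card (s \<inter> underS r v)) (frag_of (s - {v})))"

definition simplicial_homology ::
    "'a rel \<Rightarrow> 'a set set \<Rightarrow> int \<Rightarrow> ('a set \<Rightarrow>\<^sub>0 int) set monoid" where
  "simplicial_homology r K =
     chain_homology (simplicial_chain_group K) (\<lambda>_. simplicial_boundary r K)"

text \<open>
  A finite poset is a finite set \<open>X\<close> with a relation \<open>r\<close> such that \<open>partial_order_on X r\<close>, where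
  \<open>(x, y) \<in> r\<close> means \<open>x \<le> y\<close>. Subposets are given by subsets of \<open>X\<close>. In particular,
  \<open>under r x\<close> is \<open>U\<^sub>x\<close> and \<open>underS r x\<close> is the set of elements strictly below \<open>x\<close>.
\<close>

definition order_complex :: "'a rel \<Rightarrow> 'a set \<Rightarrow> 'a set set" where
  "order_complex r Y = {s. s \<noteq> {} \<and> finite s \<and> s \<subseteq> Y \<and> s \<in> Chains r}"

definition poset_homology :: "'a rel \<Rightarrow> 'a set \<Rightarrow> int \<Rightarrow> ('a set \<Rightarrow>\<^sub>0 int) set monoid" where
  "poset_homology r Y = simplicial_homology r (order_complex r Y)"

definition reduced_poset_homology ::
    "'a rel \<Rightarrow> 'a set \<Rightarrow> int \<Rightarrow> ('a set \<Rightarrow>\<^sub>0 int) set monoid" where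
  "reduced_poset_homology r Y = simplicial_homology r (insert {} (order_complex r Y))"

text \<open>
  The empty poset is not acyclic: its reduced homology is that of the sphere of dimension -1,
  infinite cyclic in dimension -1.
\<close>

definition acyclic_poset :: "'a rel \<Rightarrow> 'a set \<Rightarrow> bool" where
  "acyclic_poset r Y \<longleftrightarrow> (\<forall>q. trivial_group (reduced_poset_homology r Y q))"

definition homology_sphere :: "'a rel \<Rightarrow> 'a set \<Rightarrow> int \<Rightarrow> bool" where
  "homology_sphere r Y n \<longleftrightarrow>
     (\<forall>q. if q = n then reduced_poset_homology r Y q \<cong> integer_group
          else trivial_group (reduced_poset_homology r Y q))"

definition maximal_chain :: "'a rel \<Rightarrow> 'a set \<Rightarrow> 'a set \<Rightarrow> bool" where
  "maximal_chain r Y s \<longleftrightarrow>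
     s \<in> order_complex r Y \<and> (\<forall>t\<in>order_complex r Y. s \<subseteq> t \<longrightarrow> t = s)"

definition chain_length :: "'a set \<Rightarrow> nat" where
  "chain_length s = card s - 1"

definition homogeneous :: "'a rel \<Rightarrow> 'a set \<Rightarrow> bool" where
  "homogeneous r Y \<longleftrightarrow>
     (\<forall>s t. maximal_chain r Y s \<longrightarrow> maximal_chain r Y t \<longrightarrow> chain_length s = chain_length t)"

definition graded_poset :: "'a set \<Rightarrow> 'a rel \<Rightarrow> bool" where
  "graded_poset X r \<longleftrightarrow> finite X \<and> partial_order_on X r \<and> (\<forall>x\<in>X. homogeneous r (under r x))"

definition poset_degree :: "'a rel \<Rightarrow> 'a \<Rightarrow> nat" where
  "poset_degree r x = Max (chain_length ` order_complex r (under r x))"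

definition cellular_poset :: "'a set \<Rightarrow> 'a rel \<Rightarrow> bool" where
  "cellular_poset X r \<longleftrightarrow> graded_poset X r \<and>
     (\<forall>x\<in>X. homology_sphere r (underS r x) (int (poset_degree r x) - 1))"

definition hasse_diagram :: "'a rel \<Rightarrow> 'a rel" where
  "hasse_diagram r =
     {(x, y). x \<in> underS r y \<and> \<not> (\<exists>z. x \<in> underS r z \<and> z \<in> underS r y)}"

definition hasse_matching :: "'a rel \<Rightarrow> 'a rel \<Rightarrow> bool" where
  "hasse_matching r M \<longleftrightarrow> M \<subseteq> hasse_diagram r \<and>
     (\<forall>(w, x)\<in>M. \<forall>(w', x')\<in>M. (w, x) \<noteq> (w', x') \<longrightarrow> {w, x} \<inter> {w', x'} = {})"

definition matching_digraph :: "'a rel \<Rightarrow> 'a rel \<Rightarrow> 'a rel" where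
  "matching_digraph r M = (hasse_diagram r \<inter> M) \<union> (hasse_diagram r - M)\<inverse>"

definition morse_matching :: "'a rel \<Rightarrow> 'a rel \<Rightarrow> bool" where
  "morse_matching r M \<longleftrightarrow> hasse_matching r M \<and> acyclic (matching_digraph r M)"

definition homologically_admissible :: "'a rel \<Rightarrow> 'a rel \<Rightarrow> bool" where
  "homologically_admissible r M \<longleftrightarrow> (\<forall>(w, x)\<in>M. acyclic_poset r (underS r x - {w}))"

definition critical_points :: "'a set \<Rightarrow> 'a rel \<Rightarrow> 'a set" where
  "critical_points X M = X - Field M"

definition critical_points_of_degree :: "'a set \<Rightarrow> 'a rel \<Rightarrow> 'a rel \<Rightarrow> int \<Rightarrow> 'a set" where
  "critical_points_of_degree X r M p = {x \<in> critical_points X M. int (poset_degree r x) = p}"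

definition num_critical :: "'a set \<Rightarrow> 'a rel \<Rightarrow> 'a rel \<Rightarrow> nat \<Rightarrow> nat" where
  "num_critical X r M p = card (critical_points_of_degree X r M (int p))"

definition morse_chain_group :: "'a set \<Rightarrow> 'a rel \<Rightarrow> 'a rel \<Rightarrow> int \<Rightarrow> ('a \<Rightarrow>\<^sub>0 int) monoid" where
  "morse_chain_group X r M p = free_Abelian_group (critical_points_of_degree X r M p)"

text \<open>
  The rank of an abelian group is the largest size of a subset that is linearly independent over
  the integers. It is meaningful when these sizes are bounded, as for finitely generated groups.
\<close>

definition int_independent :: "('c, 'm) monoid_scheme \<Rightarrow> 'c set \<Rightarrow> bool" where
  "int_independent G S \<longleftrightarrow> finite S \<and> S \<subseteq> carrier G \<and>
     (\<forall>a :: 'c \<Rightarrow> int. finprod G (\<lambda>x. x [^]\<^bsub>G\<^esub> a x) S = \<one>\<^bsub>G\<^esub> \<longrightarrow> (\<forall>x\<in>S. a x = 0))"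

definition abelian_rank :: "('c, 'm) monoid_scheme \<Rightarrow> nat" where
  "abelian_rank G = Sup (card ` {S. int_independent G S})"

definition poset_betti :: "'a set \<Rightarrow> 'a rel \<Rightarrow> nat \<Rightarrow> nat" where
  "poset_betti X r p = abelian_rank (poset_homology r X (int p))"

end

(* The critical points generate a model of the chains of X built up cell by cell. Let Y be a down-set
   closed under the matching, and consider its points of maximal degree. If one of them, x, is
   critical, removing it removes a cone over a homology sphere, so the relative homology is infinite
   cyclic, in degree deg x: the model gets one new generator. Otherwise all of them are matched
   downwards, and acyclicity of the matching digraph provides a pair (w, x) such that nothing else in Y
   lies above w: removing both leaves again a down-set, and the relative homology vanishes because
   the strict down-set of x without w is acyclic. Only cones with apex x maximal are needed.
   The Morse inequalities follow from additivity of the rank in the finitely generated model. *)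

theory Submission
  imports Defs Complex_Main "HOL-Library.Function_Algebras"
begin

section \<open>Quotients and ranks of abelian groups\<close>

text \<open>The homology of the successive quotients does not determine a differential on the
  critical points. The induction therefore carries a chain map from the free complex to the chains
  of \<open>Y\<close>, with surjectivity and injectivity on homology stated on elements; exact
  sequences turn into explicit chases. The new generator is not sent to the cone over the
  fundamental cycle itself but to this cone corrected by a chain of the smaller set, because its
  boundary has to lie in the image of the old generators; the preimage of that boundary is the value
  of the new differential. All relative computations rest on one formula for the boundary of a cone.
  It is uniform only if the empty simplex is kept, so chains are handled with the augmented boundary
  and the empty simplex is discarded afterwards. Rank is defined by integer independent sets; its
  additivity comes from embedding integer combinations in rational functions and comparing
  dimensions. This needs finitely many generators, so Betti numbers are first transferred to the
  model by the isomorphism on homology.\<close>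

lemma (in comm_group) coset_eq_iff:
  assumes "subgroup N G" "a \<in> carrier G" "b \<in> carrier G"
  shows "N #> a = N #> b \<longleftrightarrow> a \<otimes> inv b \<in> N"
proof -
  interpret subgroup N G by fact
  show ?thesis
  proof
    assume "N #> a = N #> b"
    then have "a \<in> N #> b"
      using assms(2) rcos_self[OF assms(2,1)] by simp
    then show "a \<otimes> inv b \<in> N"
      using assms(2,3) rcos_module_imp[OF group_axioms] by auto
  next
    assume "a \<otimes> inv b \<in> N"
    then have "a \<in> N #> b"
      using assms(2,3) rcos_module_rev[OF group_axioms] by auto
    then show "N #> a = N #> b"
      using assms repr_independence by metis
  qed
qed

lemma (in comm_group) coset_hom:
  assumes "subgroup N G"
  shows "(\<lambda>a. N #> a) \<in> hom G (G Mod N)"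
  using assms by (auto intro!: normal.r_coset_hom_Mod subgroup_imp_normal)

lemma (in comm_group) trivial_Mod_imp_subset:
  assumes "subgroup N G" "trivial_group (G Mod N)"
  shows "carrier G \<subseteq> N"
proof
  fix a assume a: "a \<in> carrier G"
  then have "N #> a \<in> carrier (G Mod N)"
    by (simp add: carrier_FactGroup)
  then have "N #> a = N"
    using assms(2) by (auto simp: trivial_group_def)
  then show "a \<in> N"
    using rcos_self[OF a assms(1)] by simp
qed

text \<open>The quotient map followed by the isomorphism is a homomorphism to the integers with
  kernel \<open>N\<close>, and \<open>z\<close> is a preimage of 1. The homology of a sphere enters
  in this form: every class is a multiple of one class, which has infinite order.\<close>

lemma (in comm_group) Mod_iso_integer_group_imp:
  assumes N: "subgroup N G" and iso: "G Mod N \<cong> integer_group"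
  obtains z where "z \<in> carrier G" "\<And>c. c \<in> carrier G \<Longrightarrow> \<exists>n::int. c \<otimes> inv (z [^] n) \<in> N"
    "\<And>n::int. z [^] n \<in> N \<Longrightarrow> n = 0"
proof -
  obtain h where h: "h \<in> iso (G Mod N) integer_group"
    using iso by (auto simp: is_iso_def)
  interpret Q: comm_group "G Mod N"
    using abelian_FactGroup[OF N] .
  have hom: "h \<in> hom (G Mod N) integer_group" and inj: "inj_on h (carrier (G Mod N))"
    and surj: "h ` carrier (G Mod N) = UNIV"
    using h by (auto simp: iso_def bij_betw_def)
  define k where "k a = h (N #> a)" for a
  have k: "k \<in> hom G integer_group"
    using Group.hom_compose[OF coset_hom[OF N] hom] by (simp add: k_def[abs_def] o_def)
  interpret k: group_hom G integer_group k
    using k by (simp add: group_hom_def group_hom_axioms_def)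
  have "1 \<in> h ` carrier (G Mod N)"
    using surj by simp
  then obtain z where z: "z \<in> carrier G" "k z = 1"
    by (auto simp: carrier_FactGroup k_def)
  have zn: "k (z [^] n) = n" for n :: int
    using k.hom_int_pow[OF z(1), of n] z(2) by simp
  have kN: "k a = 0 \<longleftrightarrow> a \<in> N" if "a \<in> carrier G" for a
  proof -
    have "k a = 0 \<longleftrightarrow> h (N #> a) = h (N #> \<one>)"
      using k.hom_one by (simp add: k_def)
    also have "\<dots> \<longleftrightarrow> N #> a = N #> \<one>"
      using that inj by (auto simp: inj_on_def carrier_FactGroup)
    also have "\<dots> \<longleftrightarrow> a \<in> N"
      using coset_eq_iff[OF N that one_closed] that by simp
    finally show ?thesis .
  qed
  show thesis
  proof (rule that[OF z(1)])
    fix c assume c: "c \<in> carrier G"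
    have "k (c \<otimes> inv (z [^] k c)) = 0"
      using c z zn[of "k c"] by simp
    moreover have "c \<otimes> inv (z [^] k c) \<in> carrier G"
      using c z(1) by (intro m_closed inv_closed int_pow_closed)
    ultimately have "c \<otimes> inv (z [^] k c) \<in> N"
      by (simp only: kN)
    then show "\<exists>n::int. c \<otimes> inv (z [^] n) \<in> N"
      by (rule exI)
  next
    fix n :: int assume "z [^] n \<in> N"
    moreover have "z [^] n \<in> carrier G"
      using z(1) by (rule int_pow_closed)
    ultimately have "k (z [^] n) = 0"
      by (simp only: kN)
    then show "n = 0"
      by (simp only: zn)
  qed
qed

text \<open>First isomorphism theorem for \<open>f\<close> followed by the quotient map of
  \<open>G'\<close>: \<open>inj\<close> makes \<open>N\<close> the kernel and \<open>surj\<close>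
  makes the composition onto. For cycles and boundaries these are the element forms of bijectivity
  on homology.\<close>

lemma Mod_iso_Mod:
  assumes "comm_group G" "comm_group G'" "subgroup N G" "subgroup N' G'"
    and f: "f \<in> hom G G'"
    and inj: "\<And>a. a \<in> carrier G \<Longrightarrow> f a \<in> N' \<longleftrightarrow> a \<in> N"
    and surj: "\<And>b. b \<in> carrier G' \<Longrightarrow> \<exists>a\<in>carrier G. b \<otimes>\<^bsub>G'\<^esub> inv\<^bsub>G'\<^esub> f a \<in> N'"
  shows "G Mod N \<cong> G' Mod N'"
proof -
  interpret G: comm_group G by fact
  interpret G': comm_group G' by fact
  have cl: "f a \<in> carrier G'" if "a \<in> carrier G" for a
    using f that by (auto simp: hom_def)
  interpret k: group_hom G "G' Mod N'" "\<lambda>a. N' #>\<^bsub>G'\<^esub> f a"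
    using hom_compose[OF f G'.coset_hom[OF assms(4)]] G'.abelian_FactGroup[OF assms(4)]
    by (auto simp: group_hom_def group_hom_axioms_def o_def comm_group.axioms)
  have "kernel G (G' Mod N') (\<lambda>a. N' #>\<^bsub>G'\<^esub> f a) = {a \<in> carrier G. f a \<in> N'}"
    using G'.coset_eq_iff[OF assms(4) cl G'.one_closed] cl subgroup.subset[OF assms(4)]
    by (auto simp: kernel_def)
  also have "\<dots> = N"
    using inj subgroup.subset[OF assms(3)] by auto
  finally have ker: "kernel G (G' Mod N') (\<lambda>a. N' #>\<^bsub>G'\<^esub> f a) = N" .
  have "(\<lambda>a. N' #>\<^bsub>G'\<^esub> f a) ` carrier G = carrier (G' Mod N')"
    unfolding carrier_FactGroup
  proof (intro equalityI image_subsetI)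
    fix b assume b: "b \<in> carrier G'"
    then obtain a where "a \<in> carrier G" "b \<otimes>\<^bsub>G'\<^esub> inv\<^bsub>G'\<^esub> f a \<in> N'"
      using surj by blast
    then show "N' #>\<^bsub>G'\<^esub> b \<in> (\<lambda>a. N' #>\<^bsub>G'\<^esub> f a) ` carrier G"
      using G'.coset_eq_iff[OF assms(4) b cl] by auto
  qed (use cl in auto)
  from k.FactGroup_iso[OF this] show ?thesis
    by (simp add: ker)
qed

lemma hom_finprod_comm_group:
  assumes "comm_group G" "comm_group H" "h \<in> hom G H" "f \<in> S \<rightarrow> carrier G"
  shows "h (finprod G f S) = finprod H (\<lambda>x. h (f x)) S"
proof -
  interpret G: comm_group G by fact
  interpret H: comm_group H by fact
  interpret h: group_hom G H h
    using assms(3) by (simp add: group_hom_def group_hom_axioms_def G.is_group H.is_group)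
  show ?thesis
    using assms(4)
  proof (induction S rule: infinite_finite_induct)
    case (insert x S)
    then show ?case
      by (simp add: Pi_iff)
  qed simp_all
qed

text \<open>For a subgroup \<open>N\<close>, this is integer independence of the cosets of
  \<open>S\<close> in the quotient, phrased on representatives so that ranks of quotients can be
  counted without handling cosets.\<close>

definition indep_mod :: "('c, 'm) monoid_scheme \<Rightarrow> 'c set \<Rightarrow> 'c set \<Rightarrow> bool" where
  "indep_mod G N S \<longleftrightarrow> finite S \<and> S \<subseteq> carrier G \<and>
     (\<forall>a :: 'c \<Rightarrow> int. finprod G (\<lambda>x. x [^]\<^bsub>G\<^esub> a x) S \<in> N \<longrightarrow> (\<forall>x\<in>S. a x = 0))"

lemma int_independent_image:
  assumes "comm_group G" "comm_group H" "h \<in> hom G H" "finite S" "S \<subseteq> carrier G" "inj_on h S"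
  shows "int_independent H (h ` S) \<longleftrightarrow> indep_mod G {x \<in> carrier G. h x = \<one>\<^bsub>H\<^esub>} S"
proof -
  interpret G: comm_group G by fact
  interpret H: comm_group H by fact
  interpret h: group_hom G H h
    using assms(3) by (simp add: group_hom_def group_hom_axioms_def G.is_group H.is_group)
  have eq: "h (finprod G (\<lambda>x. x [^]\<^bsub>G\<^esub> (a x :: int)) S) = finprod H (\<lambda>x. h x [^]\<^bsub>H\<^esub> a x) S" for a
    using assms(5)
    by (subst hom_finprod_comm_group[OF assms(1-3)])
       (auto simp: subset_iff h.hom_int_pow intro!: H.finprod_cong')
  have eq2: "finprod H (\<lambda>y. y [^]\<^bsub>H\<^esub> (b y :: int)) (h ` S) = finprod H (\<lambda>x. h x [^]\<^bsub>H\<^esub> b (h x)) S" for b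
    using assms(5,6) by (subst H.finprod_reindex) (auto simp: subset_iff)
  have cl: "finprod G (\<lambda>x. x [^]\<^bsub>G\<^esub> (a x :: int)) S \<in> carrier G" for a
    using assms(5) by (intro G.finprod_closed) auto
  show ?thesis
  proof
    assume L: "int_independent H (h ` S)"
    show "indep_mod G {x \<in> carrier G. h x = \<one>\<^bsub>H\<^esub>} S"
      unfolding indep_mod_def
    proof (intro conjI allI impI assms)
      fix a :: "'a \<Rightarrow> int"
      assume a: "finprod G (\<lambda>x. x [^]\<^bsub>G\<^esub> a x) S \<in> {x \<in> carrier G. h x = \<one>\<^bsub>H\<^esub>}"
      define b where "b y = a (inv_into S h y)" for y
      have ba: "b (h x) = a x" if "x \<in> S" for x
        using that assms(6) by (simp add: b_def)
      have "finprod H (\<lambda>y. y [^]\<^bsub>H\<^esub> b y) (h ` S) = finprod H (\<lambda>x. h x [^]\<^bsub>H\<^esub> a x) S"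
        unfolding eq2 using assms(5) ba by (intro H.finprod_cong') (auto simp: subset_iff)
      also have "\<dots> = \<one>\<^bsub>H\<^esub>"
        using a eq by simp
      finally have "\<forall>y\<in>h ` S. b y = 0"
        using L unfolding int_independent_def by blast
      then show "\<forall>x\<in>S. a x = 0"
        using ba by simp
    qed
  next
    assume R: "indep_mod G {x \<in> carrier G. h x = \<one>\<^bsub>H\<^esub>} S"
    show "int_independent H (h ` S)"
      unfolding int_independent_def
    proof (intro conjI allI impI)
      fix b :: "'c \<Rightarrow> int"
      assume "finprod H (\<lambda>y. y [^]\<^bsub>H\<^esub> b y) (h ` S) = \<one>\<^bsub>H\<^esub>"
      then have "h (finprod G (\<lambda>x. x [^]\<^bsub>G\<^esub> b (h x)) S) = \<one>\<^bsub>H\<^esub>"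
        by (simp only: eq eq2)
      then have "finprod G (\<lambda>x. x [^]\<^bsub>G\<^esub> b (h x)) S \<in> {x \<in> carrier G. h x = \<one>\<^bsub>H\<^esub>}"
        using cl by simp
      then have "\<forall>x\<in>S. b (h x) = 0"
        by (rule conjunct2[OF conjunct2[OF R[unfolded indep_mod_def]], THEN spec, THEN mp])
      then show "\<forall>y\<in>h ` S. b y = 0"
        by simp
    next
      show "finite (h ` S)"
        using assms(4) by simp
      show "h ` S \<subseteq> carrier H"
        using assms(5) by auto
    qed
  qed
qed

text \<open>Independent sets of \<open>H\<close> lift along \<open>h\<close> to sets of the same
  size, and conversely \<open>h\<close> is injective on a set that is independent modulo its kernel.
  The two families thus have the same cardinalities.\<close>

lemma abelian_rank_surj:
  assumes "comm_group G" "comm_group H" "h \<in> hom G H" "h ` carrier G = carrier H"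
  shows "abelian_rank H = Sup (card ` {S. indep_mod G {x \<in> carrier G. h x = \<one>\<^bsub>H\<^esub>} S})"
proof -
  interpret G: comm_group G by fact
  interpret H: comm_group H by fact
  interpret h: group_hom G H h
    using assms(3) by (simp add: group_hom_def group_hom_axioms_def G.is_group H.is_group)
  let ?N = "{x \<in> carrier G. h x = \<one>\<^bsub>H\<^esub>}"
  have "card ` {S. int_independent H S} = card ` {S. indep_mod G ?N S}"
  proof (intro equalityI subsetI)
    fix n assume "n \<in> card ` {S. int_independent H S}"
    then obtain T where T: "n = card T" "int_independent H T"
      by auto
    then have "T \<subseteq> h ` carrier G" "finite T"
      using assms(4) by (auto simp: int_independent_def)
    then obtain S where S: "S \<subseteq> carrier G" "inj_on h S" "T = h ` S"
      by (auto simp: subset_image_inj)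
    then have "finite S"
      using \<open>finite T\<close> finite_image_iff by blast
    then have "indep_mod G ?N S"
      using int_independent_image[OF assms(1-3)] S T by blast
    then show "n \<in> card ` {S. indep_mod G ?N S}"
      using S T by (auto simp: card_image)
  next
    fix n assume "n \<in> card ` {S. indep_mod G ?N S}"
    then obtain S where S: "n = card S" "indep_mod G ?N S"
      by auto
    then have fS: "finite S" "S \<subseteq> carrier G"
      by (auto simp: indep_mod_def)
    have inj: "inj_on h S"
    proof (rule inj_onI, rule ccontr)
      fix x y assume xy: "x \<in> S" "y \<in> S" "h x = h y" "x \<noteq> y"
      \<comment> \<open>If \<open>h x = h y\<close>, then the difference of \<open>x\<close> and
        \<open>y\<close> lies in the kernel, a relation with a nonzero coefficient.\<close>
      define a :: "'a \<Rightarrow> int" where "a z = (if z = x then 1 else if z = y then -1 else 0)" for z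
      have c: "x \<in> carrier G" "y \<in> carrier G"
        using xy fS by auto
      have "finprod G (\<lambda>z. z [^]\<^bsub>G\<^esub> a z) S = finprod G (\<lambda>z. z [^]\<^bsub>G\<^esub> a z) {x, y}"
        using xy fS by (intro G.finprod_mono_neutral_cong_right) (auto simp: a_def)
      also have "\<dots> = x \<otimes>\<^bsub>G\<^esub> inv\<^bsub>G\<^esub> y"
        using xy c by (simp add: a_def G.int_pow_neg)
      also have "\<dots> \<in> ?N"
        using xy c by simp
      finally have "a x = 0"
        using S(2) xy(1) unfolding indep_mod_def by blast
      then show False
        by (simp add: a_def)
    qed
    then have "int_independent H (h ` S)"
      using int_independent_image[OF assms(1-3) fS] S(2) by blast
    then show "n \<in> card ` {S. int_independent H S}"
      using S(1) card_image[OF inj] by (metis image_eqI mem_Collect_eq)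
  qed
  then show ?thesis
    by (simp add: abelian_rank_def)
qed

lemma abelian_rank_iso:
  assumes "comm_group G" "comm_group H" "G \<cong> H"
  shows "abelian_rank G = abelian_rank H"
proof -
  interpret G: comm_group G by fact
  interpret H: comm_group H by fact
  obtain h where h: "h \<in> iso G H"
    using assms(3) by (auto simp: is_iso_def)
  then interpret h: group_hom G H h
    by (auto simp: group_hom_def group_hom_axioms_def G.is_group H.is_group iso_def)
  have "h ` carrier G = carrier H" "inj_on h (carrier G)"
    using h by (auto simp: iso_def bij_betw_def)
  moreover have "indep_mod G {x \<in> carrier G. h x = \<one>\<^bsub>H\<^esub>} = int_independent G"
  proof -
    have "{x \<in> carrier G. h x = \<one>\<^bsub>H\<^esub>} = {\<one>\<^bsub>G\<^esub>}"
      using \<open>inj_on h (carrier G)\<close> by (auto dest: inj_onD[where y = "\<one>\<^bsub>G\<^esub>"])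
    then show ?thesis
      by (auto simp: fun_eq_iff indep_mod_def int_independent_def)
  qed
  ultimately show ?thesis
    using abelian_rank_surj[OF assms(1,2) h.homh] by (simp add: abelian_rank_def)
qed

lemma abelian_rank_Mod:
  assumes "comm_group G" "subgroup N G"
  shows "abelian_rank (G Mod N) = Sup (card ` {S. indep_mod G N S})"
proof -
  interpret G: comm_group G by fact
  have "{x \<in> carrier G. N #>\<^bsub>G\<^esub> x = \<one>\<^bsub>G Mod N\<^esub>} = N"
    using G.coset_eq_iff[OF assms(2) _ G.one_closed] subgroup.subset[OF assms(2)] by auto
  then show ?thesis
    using abelian_rank_surj[OF assms(1) G.abelian_FactGroup[OF assms(2)] G.coset_hom[OF assms(2)]]
    by (simp add: carrier_FactGroup)
qed

section \<open>Ranks of groups of integer combinations\<close>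

text \<open>Chain groups, cycles and boundaries all take this shape, so questions about subgroups
  reduce to closure under differences.\<close>

definition frag_group :: "('b \<Rightarrow>\<^sub>0 int) set \<Rightarrow> ('b \<Rightarrow>\<^sub>0 int) monoid" where
  "frag_group Z = \<lparr>carrier = Z, monoid.mult = (+), one = 0\<rparr>"

definition frag_subgroup :: "('b \<Rightarrow>\<^sub>0 int) set \<Rightarrow> bool" where
  "frag_subgroup Z \<longleftrightarrow> 0 \<in> Z \<and> (\<forall>a\<in>Z. \<forall>b\<in>Z. a - b \<in> Z)"

lemma frag_group_simps [simp]:
  "carrier (frag_group Z) = Z" "a \<otimes>\<^bsub>frag_group Z\<^esub> b = a + b" "\<one>\<^bsub>frag_group Z\<^esub> = 0"
  by (simp_all add: frag_group_def)

lemma frag_subgroupD: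
  assumes "frag_subgroup Z"
  shows "0 \<in> Z" "\<And>a b. a \<in> Z \<Longrightarrow> b \<in> Z \<Longrightarrow> a - b \<in> Z" "\<And>a. a \<in> Z \<Longrightarrow> - a \<in> Z"
    "\<And>a b. a \<in> Z \<Longrightarrow> b \<in> Z \<Longrightarrow> a + b \<in> Z"
proof -
  show 0: "0 \<in> Z" and diff: "\<And>a b. a \<in> Z \<Longrightarrow> b \<in> Z \<Longrightarrow> a - b \<in> Z"
    using assms by (auto simp: frag_subgroup_def)
  show neg: "\<And>a. a \<in> Z \<Longrightarrow> - a \<in> Z"
    using diff[OF 0] by simp
  show "\<And>a b. a \<in> Z \<Longrightarrow> b \<in> Z \<Longrightarrow> a + b \<in> Z"
    using diff neg by (metis diff_minus_eq_add)
qed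

lemma frag_subgroup_cmul:
  assumes "frag_subgroup Z" "a \<in> Z"
  shows "frag_cmul n a \<in> Z"
proof -
  have nat: "frag_cmul (int m) a \<in> Z" for m
    by (induction m) (auto simp: frag_cmul_distrib frag_subgroupD[OF assms(1)] assms(2))
  then have "- frag_cmul (int m) a \<in> Z" for m
    by (intro frag_subgroupD(3)[OF assms(1)])
  then show ?thesis
    using nat by (cases n rule: int_cases2) auto
qed

lemma frag_subgroup_image:
  assumes "frag_subgroup Z" "\<And>a b. f (a - b) = f a - f b"
  shows "frag_subgroup (f ` Z)"
  unfolding frag_subgroup_def
proof (intro conjI ballI)
  show "0 \<in> f ` Z"
    using frag_subgroupD(1)[OF assms(1)] assms(2)[of 0 0] by (intro image_eqI[of _ _ 0]) auto
  fix u v assume "u \<in> f ` Z" "v \<in> f ` Z"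
  then obtain a b where "a \<in> Z" "b \<in> Z" "u - v = f (a - b)"
    using assms(2) by fastforce
  then show "u - v \<in> f ` Z"
    using frag_subgroupD(2)[OF assms(1)] by simp
qed

lemma subgroup_frag_group_iff:
  assumes "frag_subgroup Z"
  shows "subgroup N (frag_group Z) \<longleftrightarrow> N \<subseteq> Z \<and> frag_subgroup N"
proof -
  have inv: "inv\<^bsub>frag_group Z\<^esub> a = - a" if "a \<in> Z" for a
  proof -
    have "group (frag_group Z)"
      by (rule groupI) (auto simp: frag_subgroupD[OF assms] intro: bexI[of _ "- x" for x])
    then show ?thesis
      using that by (auto intro!: group.inv_equality simp: frag_subgroupD[OF assms])
  qed
  show ?thesis
  proof
    assume "subgroup N (frag_group Z)"
    then interpret subgroup N "frag_group Z" .
    have sub: "N \<subseteq> Z"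
      using subset by simp
    have "a - b \<in> N" if "a \<in> N" "b \<in> N" for a b
    proof -
      have "inv\<^bsub>frag_group Z\<^esub> b \<in> N" "b \<in> Z"
        using that sub by auto
      then show ?thesis
        using m_closed[OF that(1), of "- b"] inv by simp
    qed
    then show "N \<subseteq> Z \<and> frag_subgroup N"
      using sub one_closed by (simp add: frag_subgroup_def)
  next
    assume "N \<subseteq> Z \<and> frag_subgroup N"
    then show "subgroup N (frag_group Z)"
      by (auto simp: subgroup_def frag_subgroupD inv subset_iff)
  qed
qed

lemma comm_group_frag_group:
  assumes "frag_subgroup Z"
  shows "comm_group (frag_group Z)"
  by (rule comm_groupI) (auto simp: frag_subgroupD[OF assms] intro: bexI[of _ "- x" for x])

lemma inv_frag_group:
  assumes "frag_subgroup Z" "a \<in> Z"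
  shows "inv\<^bsub>frag_group Z\<^esub> a = - a"
proof -
  interpret comm_group "frag_group Z"
    using assms(1) by (rule comm_group_frag_group)
  show ?thesis
    using assms by (auto intro!: inv_equality simp: frag_subgroupD)
qed

lemma int_pow_frag_group:
  fixes n :: int
  assumes "frag_subgroup Z" "a \<in> Z"
  shows "a [^]\<^bsub>frag_group Z\<^esub> n = frag_cmul n a"
proof -
  \<comment> \<open>The inclusion into the free abelian group on all generators transports the known
    formula for integer powers.\<close>
  interpret group_hom "frag_group Z" "free_Abelian_group UNIV" "\<lambda>x. x"
    using assms(1) by (auto simp: group_hom_def group_hom_axioms_def hom_def comm_group_frag_group comm_group.axioms)
  show ?thesis
    using hom_int_pow[of a n] assms by simp
qed

lemma finprod_frag_group:
  assumes "frag_subgroup Z" "\<And>x. x \<in> S \<Longrightarrow> f x \<in> Z"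
  shows "finprod (frag_group Z) f S = sum f S"
proof -
  interpret comm_group "frag_group Z"
    using assms(1) by (rule comm_group_frag_group)
  show ?thesis
    using assms(2)
    by (induction S rule: infinite_finite_induct) (auto simp: Pi_iff)
qed

lemma indep_mod_frag_group:
  assumes "frag_subgroup Z"
  shows "indep_mod (frag_group Z) N S \<longleftrightarrow> finite S \<and> S \<subseteq> Z \<and>
    (\<forall>a. (\<Sum>x\<in>S. frag_cmul (a x) x) \<in> N \<longrightarrow> (\<forall>x\<in>S. a x = 0))"
proof -
  have "finprod (frag_group Z) (\<lambda>x. x [^]\<^bsub>frag_group Z\<^esub> (a x :: int)) S = (\<Sum>x\<in>S. frag_cmul (a x) x)"
    if "S \<subseteq> Z" for a
    using that assms
    by (subst finprod_frag_group) (auto simp: int_pow_frag_group frag_subgroup_cmul subset_iff intro!: sum.cong)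
  then show ?thesis
    by (auto simp: indep_mod_def)
qed

section \<open>Ranks as dimensions of rational spans\<close>

definition frag_to_rat :: "('b \<Rightarrow>\<^sub>0 int) \<Rightarrow> 'b \<Rightarrow> rat" where
  "frag_to_rat c = (\<lambda>x. of_int (Poly_Mapping.lookup c x))"

interpretation rat_fun: vector_space "\<lambda>(q :: rat) (f :: 'b \<Rightarrow> rat) x. q * f x"
  by unfold_locales (auto simp: fun_eq_iff algebra_simps)

abbreviation rat_scale :: "rat \<Rightarrow> ('b \<Rightarrow> rat) \<Rightarrow> 'b \<Rightarrow> rat" where
  "rat_scale q f \<equiv> (\<lambda>x. q * f x)"

lemma frag_to_rat_simps [simp]:
  "frag_to_rat 0 = 0" "frag_to_rat (a + b) = frag_to_rat a + frag_to_rat b"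
  "frag_to_rat (a - b) = frag_to_rat a - frag_to_rat b"
  "frag_to_rat (- a) = - frag_to_rat a"
  "frag_to_rat (frag_cmul n a) = rat_scale (of_int n) (frag_to_rat a)"
  by (auto simp: frag_to_rat_def fun_eq_iff lookup_add lookup_minus)

lemma frag_to_rat_sum: "frag_to_rat (sum f S) = (\<Sum>x\<in>S. frag_to_rat (f x))"
  by (induction S rule: infinite_finite_induct) auto

lemma inj_frag_to_rat: "inj frag_to_rat"
  by (rule injI) (auto simp: frag_to_rat_def fun_eq_iff poly_mapping_eq_iff)

lemma frag_to_rat_keys_subset_span:
  "frag_to_rat ` {c. Poly_Mapping.keys c \<subseteq> F} \<subseteq> rat_fun.span ((\<lambda>x. frag_to_rat (frag_of x)) ` F)"
proof safe
  fix c :: "'a \<Rightarrow>\<^sub>0 int" assume c: "Poly_Mapping.keys c \<subseteq> F"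
  show "frag_to_rat c \<in> rat_fun.span ((\<lambda>x. frag_to_rat (frag_of x)) ` F)"
    using c
  proof (induction c rule: frag_induction)
    case zero
    show ?case
      by (simp only: frag_to_rat_simps rat_fun.span_zero)
  next
    case (diff a b)
    then show ?case
      by (simp only: frag_to_rat_simps rat_fun.span_diff)
  qed (auto intro: rat_fun.span_base)
qed

text \<open>The rank of a subgroup, read off from its rational span. The ambient space of functions
  may be infinite-dimensional; finiteness always comes from a finite set of generators containing
  the keys.\<close>

definition frag_dim :: "('b \<Rightarrow>\<^sub>0 int) set \<Rightarrow> nat" where
  "frag_dim N = rat_fun.dim (frag_to_rat ` N)"

text \<open>Clearing denominators. The span is built up by one rational multiple at a time, and the
  multiplier grows by the denominator of the new coefficient.\<close>

lemma span_frag_to_rat_denom: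
  assumes N: "frag_subgroup N" and v: "v \<in> rat_fun.span (frag_to_rat ` N)"
  shows "\<exists>m>0. \<exists>c\<in>N. rat_scale (of_int m) v = frag_to_rat c"
  using v
proof (induction rule: rat_fun.span_induct_alt)
  case base
  have "rat_scale (of_int 1) 0 = frag_to_rat (0 :: 'a \<Rightarrow>\<^sub>0 int)"
    by (simp add: fun_eq_iff)
  then show ?case
    using frag_subgroupD(1)[OF N] zero_less_one by blast
next
  case (step q x y)
  then obtain m c where m: "m > 0" "c \<in> N" "rat_scale (of_int m) y = frag_to_rat c"
    by blast
  obtain e where e: "e \<in> N" "x = frag_to_rat e"
    using step by blast
  obtain n d :: int where nd: "q = of_int n / of_int d" "d > 0"
    by (metis Fract_of_int_quotient quotient_of_div quotient_of_denom_pos prod.collapse)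
  have eq: "rat_scale (of_int (m * d)) (rat_scale q x + y)
     = frag_to_rat (frag_cmul (m * n) e + frag_cmul d c)"
  proof
    fix z
    have d0: "(of_int d :: rat) \<noteq> 0"
      using nd(2) by simp
    have mc: "frag_to_rat c z = of_int m * y z"
      using fun_cong[OF m(3), of z] by simp
    have "frag_to_rat (frag_cmul (m * n) e + frag_cmul d c) z
      = of_int m * of_int n * x z + of_int d * (of_int m * y z)"
      by (simp only: frag_to_rat_simps plus_fun_apply mc e(2) of_int_mult)
    also have "\<dots> = of_int m * of_int d * (of_int n / of_int d * x z + y z)"
      using d0 by (simp add: distrib_left)
    finally show "rat_scale (of_int (m * d)) (rat_scale q x + y) z
      = frag_to_rat (frag_cmul (m * n) e + frag_cmul d c) z"
      by (simp only: nd(1) plus_fun_apply of_int_mult)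
  qed
  have mem: "frag_cmul (m * n) e + frag_cmul d c \<in> N"
    using e(1) m(2) N by (intro frag_subgroupD(4) frag_subgroup_cmul)
  have "m * d > 0"
    using m(1) nd(2) by simp
  then show ?case
    using eq mem by blast
qed

text \<open>A basis of the rational span of \<open>N\<close> stays independent when the elements of
  \<open>S\<close> are adjoined one by one: after clearing denominators, a dependency would be an
  integer combination of \<open>S\<close> that lies in \<open>N\<close> and has a nonzero
  coefficient.\<close>

lemma indep_mod_card_le:
  assumes N: "frag_subgroup N" and Z: "frag_subgroup Z" "N \<subseteq> Z" "Z \<subseteq> {c. Poly_Mapping.keys c \<subseteq> F}" "finite F"
    and S: "indep_mod (frag_group Z) N S"
  shows "card S + frag_dim N \<le> frag_dim Z"
proof -
  have S': "finite S" "S \<subseteq> Z" "\<And>a. (\<Sum>x\<in>S. frag_cmul (a x) x) \<in> N \<Longrightarrow> \<forall>x\<in>S. a x = 0"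
    using S indep_mod_frag_group[OF Z(1)] by blast+
  obtain B where B: "B \<subseteq> frag_to_rat ` N" "rat_fun.independent B"
    "frag_to_rat ` N \<subseteq> rat_fun.span B" "card B = frag_dim N"
    unfolding frag_dim_def by (rule rat_fun.basis_exists)
  have fin: "finite C" if "rat_fun.independent C" "C \<subseteq> frag_to_rat ` Z" for C
  proof -
    have "C \<subseteq> rat_fun.span ((\<lambda>x. frag_to_rat (frag_of x)) ` F)"
      using that(2) Z(3) frag_to_rat_keys_subset_span by blast
    from rat_fun.independent_span_bound[OF finite_imageI[OF Z(4)] that(1) this] show ?thesis
      by (rule conjunct1)
  qed
  have finB: "finite B"
    using fin[OF B(2)] B(1) Z(2) by blast
  have "finite S0 \<Longrightarrow> S0 \<subseteq> S \<Longrightarrow> rat_fun.independent (frag_to_rat ` S0 \<union> B) \<and>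
      card (frag_to_rat ` S0 \<union> B) = card S0 + card B" for S0
  proof (induction S0 rule: finite_induct)
    case (insert s S0)
    \<comment> \<open>The subgroup generated by \<open>N\<close> and \<open>S0\<close>. Denominators
      can only be cleared relative to a subgroup, so the elements adjoined so far are put into
      one.\<close>
    define N' where "N' = {n + (\<Sum>x\<in>S0. frag_cmul (a x) x) | n a. n \<in> N}"
    have N': "frag_subgroup N'"
      unfolding frag_subgroup_def
    proof (intro conjI ballI)
      show "0 \<in> N'"
        unfolding N'_def using frag_subgroupD(1)[OF N]
        by (intro CollectI exI[of _ 0] exI[of _ "\<lambda>_. 0"]) auto
      fix u v assume "u \<in> N'" "v \<in> N'"
      then obtain n a m b where "n \<in> N" "m \<in> N" "u = n + (\<Sum>x\<in>S0. frag_cmul (a x) x)"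
        "v = m + (\<Sum>x\<in>S0. frag_cmul (b x) x)"
        unfolding N'_def by blast
      then have "u - v = (n - m) + (\<Sum>x\<in>S0. frag_cmul (a x - b x) x)" "n - m \<in> N"
        by (auto simp: frag_cmul_diff_distrib sum_subtractf frag_subgroupD[OF N])
      then show "u - v \<in> N'"
        unfolding N'_def by (intro CollectI exI[of _ "n - m"] exI[of _ "\<lambda>x. a x - b x"]) auto
    qed
    have NN': "n \<in> N'" if "n \<in> N" for n
      unfolding N'_def using that by (intro CollectI exI[of _ n] exI[of _ "\<lambda>_. 0"]) auto
    have SN': "x \<in> N'" if "x \<in> S0" for x
    proof -
      have "(\<Sum>y\<in>S0. frag_cmul (if y = x then 1 else 0) y) = (\<Sum>y\<in>S0. if y = x then y else 0)"
        by (intro sum.cong) auto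
      then show ?thesis
        unfolding N'_def using that insert(1) frag_subgroupD(1)[OF N]
        by (intro CollectI exI[of _ 0] exI[of _ "\<lambda>y. if y = x then 1 else 0"]) (auto simp: sum.delta)
    qed
    have notin: "frag_to_rat s \<notin> rat_fun.span (frag_to_rat ` S0 \<union> B)"
    proof
      assume "frag_to_rat s \<in> rat_fun.span (frag_to_rat ` S0 \<union> B)"
      moreover have "frag_to_rat ` S0 \<union> B \<subseteq> frag_to_rat ` N'"
        using B(1) NN' SN' by auto
      ultimately have "frag_to_rat s \<in> rat_fun.span (frag_to_rat ` N')"
        using rat_fun.span_mono by blast
      from span_frag_to_rat_denom[OF N' this] obtain m c where mc: "m > 0" "c \<in> N'"
        "rat_scale (of_int m) (frag_to_rat s) = frag_to_rat c"
        by blast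
      then have "frag_to_rat (frag_cmul m s) = frag_to_rat c"
        by simp
      then have "frag_cmul m s = c"
        by (rule injD[OF inj_frag_to_rat])
      then obtain n a where n: "n \<in> N" "frag_cmul m s = n + (\<Sum>x\<in>S0. frag_cmul (a x) x)"
        using mc(2) unfolding N'_def by blast
      \<comment> \<open>The equation for \<open>frag_cmul m s\<close> with the combination of
        \<open>S0\<close> moved to the other side: what remains is \<open>n\<close>, an element of
        \<open>N\<close>, while the coefficient \<open>m\<close> of \<open>s\<close> is
        positive.\<close>
      define b where "b x = (if x = s then m else if x \<in> S0 then - a x else 0)" for x
      have "(\<Sum>x\<in>S. frag_cmul (b x) x) = (\<Sum>x\<in>insert s S0. frag_cmul (b x) x)"
        using insert S'(1) by (intro sum.mono_neutral_right) (auto simp: b_def)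
      also have "\<dots> = frag_cmul m s + (\<Sum>x\<in>S0. frag_cmul (b x) x)"
        using insert by (simp add: b_def)
      also have "(\<Sum>x\<in>S0. frag_cmul (b x) x) = (\<Sum>x\<in>S0. - frag_cmul (a x) x)"
        using insert by (intro sum.cong) (auto simp: b_def)
      also have "frag_cmul m s + \<dots> = n"
        using n(2) by (simp add: sum_negf del: minus_frag_cmul)
      finally have "b s = 0"
        using S'(3) n(1) insert(4) by simp
      then show False
        using mc(1) by (simp add: b_def)
    qed
    then have "frag_to_rat s \<notin> frag_to_rat ` S0 \<union> B"
      by (rule contrapos_nn) (rule rat_fun.span_base)
    then show ?case
      using insert notin finB by (simp add: rat_fun.independent_insert)
  qed (use B in simp)
  from this[OF S'(1)] have ind: "rat_fun.independent (frag_to_rat ` S \<union> B)"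
    "card (frag_to_rat ` S \<union> B) = card S + card B"
    by auto
  have "frag_to_rat ` S \<union> B \<subseteq> frag_to_rat ` Z"
    using S'(2) B(1) Z(2) by blast
  then obtain C where C: "frag_to_rat ` S \<union> B \<subseteq> C" "C \<subseteq> frag_to_rat ` Z" "rat_fun.independent C"
      "frag_to_rat ` Z \<subseteq> rat_fun.span C"
    using ind(1) by (rule rat_fun.maximal_independent_subset_extend)
  have "card C = frag_dim Z"
    unfolding frag_dim_def using C by (intro rat_fun.basis_card_eq_dim)
  moreover have "card (frag_to_rat ` S \<union> B) \<le> card C"
    using C fin by (intro card_mono) auto
  ultimately show ?thesis
    using ind(2) B(4) by simp
qed

text \<open>Extend a basis of the span of \<open>N\<close> by vectors coming from \<open>Z\<close>
  to a basis of the span of \<open>Z\<close>, and lift only the new basis vectors.\<close>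

lemma indep_mod_exists:
  assumes N: "frag_subgroup N" and Z: "frag_subgroup Z" "N \<subseteq> Z" "Z \<subseteq> {c. Poly_Mapping.keys c \<subseteq> F}" "finite F"
  obtains S where "indep_mod (frag_group Z) N S" "card S + frag_dim N = frag_dim Z"
proof -
  obtain B where B: "B \<subseteq> frag_to_rat ` N" "rat_fun.independent B"
    "frag_to_rat ` N \<subseteq> rat_fun.span B" "card B = frag_dim N"
    unfolding frag_dim_def by (rule rat_fun.basis_exists)
  have "B \<subseteq> frag_to_rat ` Z"
    using B(1) Z(2) by blast
  then obtain C where C: "B \<subseteq> C" "C \<subseteq> frag_to_rat ` Z" "rat_fun.independent C"
      "frag_to_rat ` Z \<subseteq> rat_fun.span C"
    using B(2) by (rule rat_fun.maximal_independent_subset_extend)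
  have cardC: "card C = frag_dim Z"
    unfolding frag_dim_def using C by (intro rat_fun.basis_card_eq_dim)
  have "C \<subseteq> rat_fun.span ((\<lambda>x. frag_to_rat (frag_of x)) ` F)"
    using C(2) Z(3) frag_to_rat_keys_subset_span by blast
  from rat_fun.independent_span_bound[OF finite_imageI[OF Z(4)] C(3) this] have finC: "finite C"
    by (rule conjunct1)
  obtain S where S: "S \<subseteq> Z" "inj_on frag_to_rat S" "C - B = frag_to_rat ` S"
    using C(2) by (metis Diff_subset subset_image_inj subset_trans)
  have finS: "finite S"
    using S finC finite_image_iff by (metis finite_Diff)
  have "a x = 0" if sum: "(\<Sum>x\<in>S. frag_cmul (a x) x) \<in> N" and x: "x \<in> S" for a x
  proof (rule ccontr)
    assume nz: "a x \<noteq> 0"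
    \<comment> \<open>The full sum lies in \<open>N\<close>, hence in the span of \<open>B\<close>,
      and the rest is a combination of other new basis vectors. Dividing by \<open>a x\<close> would
      express one vector of \<open>C\<close> by the remaining ones.\<close>
    have eq: "frag_cmul (a x) x = (\<Sum>x\<in>S. frag_cmul (a x) x) - (\<Sum>y\<in>S - {x}. frag_cmul (a y) y)"
      using x finS by (simp add: sum.remove)
    have mem: "frag_to_rat (frag_cmul (a x) x) \<in> rat_fun.span (C - {frag_to_rat x})"
      unfolding eq frag_to_rat_simps
    proof (rule rat_fun.span_diff)
      have "frag_to_rat (\<Sum>x\<in>S. frag_cmul (a x) x) \<in> rat_fun.span B"
        using sum B(3) by blast
      moreover have "B \<subseteq> C - {frag_to_rat x}"
        using C(1) S(3) x by blast
      ultimately show "frag_to_rat (\<Sum>x\<in>S. frag_cmul (a x) x) \<in> rat_fun.span (C - {frag_to_rat x})"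
        using rat_fun.span_mono by blast
      have "frag_to_rat (frag_cmul (a y) y) \<in> rat_fun.span (C - {frag_to_rat x})" if "y \<in> S - {x}" for y
        unfolding frag_to_rat_simps
      proof (intro rat_fun.span_scale rat_fun.span_base)
        have "frag_to_rat y \<in> C - B" "frag_to_rat y \<noteq> frag_to_rat x"
          using S(2,3) x that by (auto dest: inj_onD)
        then show "frag_to_rat y \<in> C - {frag_to_rat x}"
          by blast
      qed
      then show "frag_to_rat (\<Sum>y\<in>S - {x}. frag_cmul (a y) y) \<in> rat_fun.span (C - {frag_to_rat x})"
        unfolding frag_to_rat_sum by (intro rat_fun.span_sum)
    qed
    have "rat_scale (1 / of_int (a x)) (frag_to_rat (frag_cmul (a x) x)) \<in> rat_fun.span (C - {frag_to_rat x})"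
      using mem by (rule rat_fun.span_scale)
    also have "rat_scale (1 / of_int (a x)) (frag_to_rat (frag_cmul (a x) x)) = frag_to_rat x"
      using nz by (simp add: fun_eq_iff)
    finally have "frag_to_rat x \<in> rat_fun.span (C - {frag_to_rat x})" .
    moreover have "frag_to_rat x \<in> C"
      using S(3) x by blast
    ultimately show False
      using C(3) unfolding rat_fun.dependent_def by blast
  qed
  then have "indep_mod (frag_group Z) N S"
    using indep_mod_frag_group[OF Z(1)] finS S(1) by blast
  moreover have "card S + frag_dim N = frag_dim Z"
  proof -
    have "card S = card (C - B)"
      using S by (simp add: card_image)
    also have "\<dots> = card C - card B"
      using finC C(1) by (simp add: card_Diff_subset finite_subset)
    finally show ?thesis
      using cardC B(4) card_mono[OF finC C(1)] by simp
  qed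
  ultimately show thesis
    by (rule that)
qed

text \<open>Additivity of the rank. The set from \<open>indep_mod_exists\<close> attains the bound
  of \<open>indep_mod_card_le\<close>, so the supremum is a maximum. Sums replace differences to
  avoid truncated subtraction.\<close>

lemma abelian_rank_frag_group_Mod:
  assumes N: "frag_subgroup N" and Z: "frag_subgroup Z" "N \<subseteq> Z" "Z \<subseteq> {c. Poly_Mapping.keys c \<subseteq> F}" "finite F"
  shows "Sup (card ` {S. indep_mod (frag_group Z) N S}) + frag_dim N = frag_dim Z"
    "abelian_rank (frag_group Z Mod N) + frag_dim N = frag_dim Z"
proof -
  obtain S where S: "indep_mod (frag_group Z) N S" "card S + frag_dim N = frag_dim Z"
    using indep_mod_exists[OF assms] .
  have "Sup (card ` {S. indep_mod (frag_group Z) N S}) = card S"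
  proof (rule cSup_eq_maximum)
    show "card S \<in> card ` {S. indep_mod (frag_group Z) N S}"
      using S by blast
    fix n assume "n \<in> card ` {S. indep_mod (frag_group Z) N S}"
    then show "n \<le> card S"
      using indep_mod_card_le[OF assms] S(2) by fastforce
  qed
  then show eq: "Sup (card ` {S. indep_mod (frag_group Z) N S}) + frag_dim N = frag_dim Z"
    using S(2) by simp
  show "abelian_rank (frag_group Z Mod N) + frag_dim N = frag_dim Z"
    using eq abelian_rank_Mod[OF comm_group_frag_group[OF Z(1)]] subgroup_frag_group_iff[OF Z(1)] N Z(2)
    by simp
qed

lemma frag_dim_zero [simp]: "frag_dim {0 :: 'b \<Rightarrow>\<^sub>0 int} = 0"
proof -
  have "rat_fun.dim {0 :: 'b \<Rightarrow> rat} \<le> card ({} :: ('b \<Rightarrow> rat) set)"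
    by (rule rat_fun.dim_le_card) auto
  then show ?thesis
    by (simp add: frag_dim_def)
qed

lemma frag_subgroup_zero: "frag_subgroup {0}"
  and frag_subgroup_keys: "frag_subgroup {c. Poly_Mapping.keys c \<subseteq> F}"
  by (auto simp: frag_subgroup_def dest: subsetD[OF keys_diff])

text \<open>The generators span, which bounds the dimension above; they satisfy no integer relation,
  so \<open>indep_mod_card_le\<close> with the zero subgroup bounds it below.\<close>

lemma frag_dim_keys:
  assumes "finite F"
  shows "frag_dim {c. Poly_Mapping.keys c \<subseteq> F} = card F"
proof (rule antisym)
  let ?Z = "{c. Poly_Mapping.keys c \<subseteq> F}"
  have "frag_dim ?Z \<le> card ((\<lambda>x. frag_to_rat (frag_of x)) ` F)"
    unfolding frag_dim_def
    using assms by (intro rat_fun.dim_le_card frag_to_rat_keys_subset_span) auto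
  also have "\<dots> \<le> card F"
    using assms by (rule card_image_le)
  finally show "frag_dim ?Z \<le> card F" .
  have inj: "inj_on frag_of F"
    by (simp add: frag_of_eq inj_on_def)
  have "indep_mod (frag_group ?Z) {0} (frag_of ` F)"
    unfolding indep_mod_frag_group[OF frag_subgroup_keys]
  proof (intro conjI allI impI)
    fix a :: "('a \<Rightarrow>\<^sub>0 int) \<Rightarrow> int"
    assume "(\<Sum>x\<in>frag_of ` F. frag_cmul (a x) x) \<in> {0}"
    then have 0: "(\<Sum>x\<in>F. frag_cmul (a (frag_of x)) (frag_of x)) = 0"
      by (simp add: sum.reindex[OF inj])
    have "a (frag_of y) = 0" if y: "y \<in> F" for y
    proof -
      have "Poly_Mapping.lookup (\<Sum>x\<in>F. frag_cmul (a (frag_of x)) (frag_of x)) y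
        = (\<Sum>x\<in>F. if x = y then a (frag_of x) else 0)"
        unfolding lookup_sum by (intro sum.cong) (auto simp: lookup_single when_def)
      also have "\<dots> = a (frag_of y)"
        using y assms by (simp add: sum.delta)
      finally show ?thesis
        using 0 by simp
    qed
    then show "\<forall>x\<in>frag_of ` F. a x = 0"
      by blast
  qed (use assms in auto)
  from indep_mod_card_le[OF frag_subgroup_zero frag_subgroup_keys _ order_refl assms this]
  show "card F \<le> frag_dim ?Z"
    by (simp add: card_image[OF inj])
qed

text \<open>Rank-nullity. The rank of the image is counted twice: by sets in \<open>Z\<close>
  independent modulo the kernel, and by sets in the image independent modulo 0.\<close>

lemma frag_dim_kernel_image:
  assumes Z: "frag_subgroup Z" "Z \<subseteq> {c. Poly_Mapping.keys c \<subseteq> F}" "finite F"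
    and h: "\<And>a b. h (a - b) = h a - h b" "h ` Z \<subseteq> {c. Poly_Mapping.keys c \<subseteq> F'}" "finite F'"
  shows "frag_dim {c \<in> Z. h c = 0} + frag_dim (h ` Z) = frag_dim Z"
proof -
  have h0: "h 0 = 0"
    using h(1)[of 0 0] by simp
  have hneg: "h (- a) = - h a" for a
    using h(1)[of 0 a] h0 by simp
  have hadd: "h (a + b) = h a + h b" for a b
    using h(1)[of a "- b"] hneg by simp
  have im: "frag_subgroup (h ` Z)"
    using Z(1) h(1) by (rule frag_subgroup_image)
  have ker: "frag_subgroup {c \<in> Z. h c = 0}"
    using frag_subgroupD(1,2)[OF Z(1)] h0 h(1) by (auto simp: frag_subgroup_def)
  have 1: "abelian_rank (frag_group (h ` Z)) = Sup (card ` {S. indep_mod (frag_group Z) {c \<in> Z. h c = 0} S})"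
    using abelian_rank_surj[OF comm_group_frag_group[OF Z(1)] comm_group_frag_group[OF im], of h]
    by (auto simp: hom_def hadd)
  have 2: "abelian_rank (frag_group (h ` Z)) = Sup (card ` {S. indep_mod (frag_group (h ` Z)) {0} S})"
    by (simp add: abelian_rank_def int_independent_def indep_mod_def)
  show ?thesis
    using abelian_rank_frag_group_Mod(1)[OF ker Z(1) _ Z(2,3)]
      abelian_rank_frag_group_Mod(1)[OF frag_subgroup_zero im _ h(2,3)] frag_subgroupD(1)[OF im] 1 2
    by simp
qed

section \<open>Chains of a poset and cones\<close>

lemma frag_additive_eqI:
  fixes f g :: "('b \<Rightarrow>\<^sub>0 int) \<Rightarrow> 'c :: ab_group_add"
  assumes "Poly_Mapping.keys c \<subseteq> S"
    and "\<And>a b. f (a - b) = f a - f b" "\<And>a b. g (a - b) = g a - g b"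
    and "\<And>s. s \<in> S \<Longrightarrow> f (frag_of s) = g (frag_of s)"
  shows "f c = g c"
  using assms(1)
proof (induction c rule: frag_induction)
  case zero
  show ?case
    using assms(2)[of 0 0] assms(3)[of 0 0] by (simp only: diff_self)
qed (simp_all add: assms)

lemma frag_cmul_diff: "frag_cmul n (a - b) = frag_cmul n a - frag_cmul n b"
  using frag_cmul_distrib2[of n "a - b" b] by simp

text \<open>
  All faces are kept here, the empty one included, so that this boundary does not depend on the
  subposet; the boundaries of the order complex and of its augmentation are obtained from it.
\<close>

definition aug_boundary :: "'a rel \<Rightarrow> ('a set \<Rightarrow>\<^sub>0 int) \<Rightarrow> ('a set \<Rightarrow>\<^sub>0 int)" where
  "aug_boundary r = frag_extend (\<lambda>s. \<Sum>v\<in>s.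
     frag_cmul ((-1) ^ card (s \<inter> underS r v)) (frag_of (s - {v})))"

definition drop_empty :: "('a set \<Rightarrow>\<^sub>0 int) \<Rightarrow> ('a set \<Rightarrow>\<^sub>0 int)" where
  "drop_empty = frag_extend (\<lambda>s. if s = {} then 0 else frag_of s)"

text \<open>The join with an apex. There is no sign because the apex always lies above all vertices
  of the base and so comes last in the orientation.\<close>

definition cone :: "'a \<Rightarrow> ('a set \<Rightarrow>\<^sub>0 int) \<Rightarrow> ('a set \<Rightarrow>\<^sub>0 int)" where
  "cone x = frag_extend (\<lambda>s. frag_of (insert x s))"

definition aug_chains :: "'a rel \<Rightarrow> 'a set \<Rightarrow> int \<Rightarrow> ('a set \<Rightarrow>\<^sub>0 int) set" where
  "aug_chains r Y p = {c. Poly_Mapping.keys c \<subseteq> {s \<in> insert {} (order_complex r Y). int (card s) = p + 1}}"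

definition poset_chains :: "'a rel \<Rightarrow> 'a set \<Rightarrow> int \<Rightarrow> ('a set \<Rightarrow>\<^sub>0 int) set" where
  "poset_chains r Y p = {c. Poly_Mapping.keys c \<subseteq> {s \<in> order_complex r Y. int (card s) = p + 1}}"

definition poset_boundary :: "'a rel \<Rightarrow> ('a set \<Rightarrow>\<^sub>0 int) \<Rightarrow> ('a set \<Rightarrow>\<^sub>0 int)" where
  "poset_boundary r c = drop_empty (aug_boundary r c)"

lemma aug_boundary_diff: "aug_boundary r (a - b) = aug_boundary r a - aug_boundary r b"
  and drop_empty_diff: "drop_empty (a - b) = drop_empty a - drop_empty b"
  and cone_diff: "cone x (a - b) = cone x a - cone x b"
  and poset_boundary_diff: "poset_boundary r (a - b) = poset_boundary r a - poset_boundary r b"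
  by (simp_all add: aug_boundary_def drop_empty_def cone_def poset_boundary_def frag_extend_diff)

lemma aug_boundary_add: "aug_boundary r (a + b) = aug_boundary r a + aug_boundary r b"
  and drop_empty_add: "drop_empty (a + b) = drop_empty a + drop_empty b"
  and cone_add: "cone x (a + b) = cone x a + cone x b"
  and poset_boundary_add: "poset_boundary r (a + b) = poset_boundary r a + poset_boundary r b"
  by (simp_all add: aug_boundary_def drop_empty_def cone_def poset_boundary_def frag_extend_add)

lemma aug_boundary_cmul: "aug_boundary r (frag_cmul n a) = frag_cmul n (aug_boundary r a)"
  and drop_empty_cmul: "drop_empty (frag_cmul n a) = frag_cmul n (drop_empty a)"
  and cone_cmul: "cone x (frag_cmul n a) = frag_cmul n (cone x a)"
  and poset_boundary_cmul: "poset_boundary r (frag_cmul n a) = frag_cmul n (poset_boundary r a)"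
  by (simp_all add: aug_boundary_def drop_empty_def cone_def poset_boundary_def frag_extend_cmul)

lemma boundary_zero [simp]:
  "aug_boundary r 0 = 0" "drop_empty 0 = 0" "cone x 0 = 0" "poset_boundary r 0 = 0"
  by (simp_all add: aug_boundary_def drop_empty_def cone_def poset_boundary_def)

lemma frag_of_simps [simp]:
  "drop_empty (frag_of s) = (if s = {} then 0 else frag_of s)"
  "cone x (frag_of s) = frag_of (insert x s)"
  "aug_boundary r (frag_of s) = (\<Sum>v\<in>s. frag_cmul ((-1) ^ card (s \<inter> underS r v)) (frag_of (s - {v})))"
  by (simp_all add: aug_boundary_def drop_empty_def cone_def)

lemma frag_subgroup_aug_chains: "frag_subgroup (aug_chains r Y p)"
  and frag_subgroup_poset_chains: "frag_subgroup (poset_chains r Y p)"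
  unfolding aug_chains_def poset_chains_def by (rule frag_subgroup_keys)+

lemmas aug_chains_closed = frag_subgroupD[OF frag_subgroup_aug_chains]
  frag_subgroup_cmul[OF frag_subgroup_aug_chains]
lemmas poset_chains_closed = frag_subgroupD[OF frag_subgroup_poset_chains]
  frag_subgroup_cmul[OF frag_subgroup_poset_chains]

lemma order_complex_mono: "Y \<subseteq> Z \<Longrightarrow> order_complex r Y \<subseteq> order_complex r Z"
  by (auto simp: order_complex_def)

lemma poset_chains_mono: "Y \<subseteq> Z \<Longrightarrow> poset_chains r Y p \<subseteq> poset_chains r Z p"
  and aug_chains_mono: "Y \<subseteq> Z \<Longrightarrow> aug_chains r Y p \<subseteq> aug_chains r Z p"
  and poset_chains_subset_aug_chains: "poset_chains r Y p \<subseteq> aug_chains r Y p"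
  using order_complex_mono[of Y Z r] by (auto simp: poset_chains_def aug_chains_def)

lemma frag_extend_mem_keys:
  assumes "Poly_Mapping.keys c \<subseteq> S" "\<And>s. s \<in> S \<Longrightarrow> Poly_Mapping.keys (f s) \<subseteq> T"
  shows "Poly_Mapping.keys (frag_extend f c) \<subseteq> T"
  using keys_frag_extend[of f c] assms by blast

lemma keys_cmul_frag_of: "Poly_Mapping.keys (frag_cmul n (frag_of s)) \<subseteq> {s}"
  using keys_cmul[of n "frag_of s"] by simp

lemma aug_boundary_closed:
  assumes "c \<in> aug_chains r Y p"
  shows "aug_boundary r c \<in> aug_chains r Y (p - 1)"
  unfolding aug_boundary_def aug_chains_def mem_Collect_eq
proof (rule frag_extend_mem_keys)
  show "Poly_Mapping.keys c \<subseteq> {s \<in> insert {} (order_complex r Y). int (card s) = p + 1}"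
    using assms by (simp add: aug_chains_def)
  fix s assume s: "s \<in> {s \<in> insert {} (order_complex r Y). int (card s) = p + 1}"
  then have "finite s" "s \<subseteq> Y" "s \<in> Chains r"
    by (auto simp: order_complex_def Chains_def)
  have "s - {v} \<in> {s \<in> insert {} (order_complex r Y). int (card s) = p - 1 + 1}" if "v \<in> s" for v
  proof -
    have "Suc (card (s - {v})) = card s"
      using \<open>finite s\<close> that by (rule card_Suc_Diff1)
    then have "int (card (s - {v})) = p - 1 + 1"
      using s by simp
    then show ?thesis
      using \<open>finite s\<close> \<open>s \<subseteq> Y\<close> \<open>s \<in> Chains r\<close> by (auto simp: order_complex_def Chains_def)
  qed
  then show "Poly_Mapping.keys (\<Sum>v\<in>s. frag_cmul ((-1) ^ card (s \<inter> underS r v)) (frag_of (s - {v})))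
    \<subseteq> {s \<in> insert {} (order_complex r Y). int (card s) = p - 1 + 1}"
    by (intro order_trans[OF keys_sum] UN_least order_trans[OF keys_cmul_frag_of]) blast
qed

lemma drop_empty_closed:
  assumes "c \<in> aug_chains r Y p"
  shows "drop_empty c \<in> poset_chains r Y p"
  unfolding drop_empty_def poset_chains_def mem_Collect_eq
  by (rule frag_extend_mem_keys[OF assms[unfolded aug_chains_def mem_Collect_eq]]) auto

lemma drop_empty_id:
  assumes "c \<in> poset_chains r Y p"
  shows "drop_empty c = c"
  by (rule frag_additive_eqI[where g = "\<lambda>c. c", OF assms[unfolded poset_chains_def mem_Collect_eq]])
     (auto simp: drop_empty_diff order_complex_def)

lemma poset_boundary_closed:
  assumes "c \<in> poset_chains r Y p"
  shows "poset_boundary r c \<in> poset_chains r Y (p - 1)"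
  unfolding poset_boundary_def
  using assms poset_chains_subset_aug_chains by (intro drop_empty_closed aug_boundary_closed) blast

text \<open>The empty simplex has boundary 0. Hence the unreduced boundary squares to 0 as soon as
  the augmented one does.\<close>

lemma aug_boundary_drop_empty: "aug_boundary r (drop_empty c) = aug_boundary r c"
  by (rule frag_additive_eqI[where S = UNIV]) (simp_all add: aug_boundary_diff drop_empty_diff)

lemma reduced_simplicial_boundary_eq:
  assumes "c \<in> aug_chains r Y p"
  shows "simplicial_boundary r (insert {} (order_complex r Y)) c = aug_boundary r c"
  unfolding simplicial_boundary_def aug_boundary_def
proof (rule frag_extend_eq)
  fix s assume "s \<in> Poly_Mapping.keys c"
  then have "s \<in> insert {} (order_complex r Y)"
    using assms by (auto simp: aug_chains_def)
  then have "{v. v \<in> s \<and> s - {v} \<in> insert {} (order_complex r Y)} = s"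
    by (auto simp: order_complex_def Chains_def)
  then show "(\<Sum>v | v \<in> s \<and> s - {v} \<in> insert {} (order_complex r Y).
      frag_cmul ((-1) ^ card (s \<inter> underS r v)) (frag_of (s - {v})))
    = (\<Sum>v\<in>s. frag_cmul ((-1) ^ card (s \<inter> underS r v)) (frag_of (s - {v})))"
    by simp
qed

lemma simplicial_boundary_eq:
  assumes "c \<in> poset_chains r Y p"
  shows "simplicial_boundary r (order_complex r Y) c = poset_boundary r c"
  unfolding poset_boundary_def simplicial_boundary_def
proof (rule frag_additive_eqI[OF assms[unfolded poset_chains_def mem_Collect_eq]])
  fix s assume "s \<in> {s \<in> order_complex r Y. int (card s) = p + 1}"
  then have s: "s \<in> order_complex r Y"
    by simp
  have "drop_empty (aug_boundary r (frag_of s))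
      = (\<Sum>v\<in>s. drop_empty (frag_cmul ((-1) ^ card (s \<inter> underS r v)) (frag_of (s - {v}))))"
    using s by (simp add: drop_empty_def frag_extend_sum order_complex_def del: frag_extend_of)
  \<comment> \<open>The only face that can be missing from the order complex is the empty one, and
    \<open>drop_empty\<close> kills exactly that term.\<close>
  also have "\<dots> = (\<Sum>v | v \<in> s \<and> s - {v} \<in> order_complex r Y.
      frag_cmul ((-1) ^ card (s \<inter> underS r v)) (frag_of (s - {v})))"
    using s by (intro sum.mono_neutral_cong_right) (auto simp: order_complex_def Chains_def drop_empty_cmul)
  finally show "frag_extend (\<lambda>s. \<Sum>v | v \<in> s \<and> s - {v} \<in> order_complex r Y.
      frag_cmul ((-1) ^ card (s \<inter> underS r v)) (frag_of (s - {v}))) (frag_of s)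
    = drop_empty (aug_boundary r (frag_of s))"
    by simp
qed (simp_all add: frag_extend_diff aug_boundary_diff drop_empty_diff)

section \<open>Boundaries of cones and decomposition along a maximal point\<close>

locale finite_poset =
  fixes X :: "'a set" and r :: "'a rel"
  assumes finite_X: "finite X" and partial_order: "partial_order_on X r"
begin

lemma refl: "x \<in> X \<Longrightarrow> (x, x) \<in> r"
  and trans: "(x, y) \<in> r \<Longrightarrow> (y, z) \<in> r \<Longrightarrow> (x, z) \<in> r"
  and antisym: "(x, y) \<in> r \<Longrightarrow> (y, x) \<in> r \<Longrightarrow> x = y"
  and rel_in: "(x, y) \<in> r \<Longrightarrow> x \<in> X \<and> y \<in> X"
  using partial_order
  by (auto simp: partial_order_on_def preorder_on_def refl_on_def intro: transD dest: antisymD)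

lemma underS_subset: "underS r x \<subseteq> X"
  using rel_in by (auto simp: underS_def)

lemma insert_chain:
  assumes "x \<in> X" "s \<in> insert {} (order_complex r (underS r x))"
  shows "x \<notin> s" "finite s" "insert x s \<in> order_complex r (insert x s)"
  using assms refl[OF assms(1)] by (auto simp: order_complex_def underS_def Chains_def)

text \<open>As \<open>x\<close> is the last vertex, a face that keeps \<open>x\<close> has the same
  sign as the corresponding face of \<open>s\<close>, and the face opposite \<open>x\<close> has all
  of \<open>s\<close> below the removed vertex.\<close>

lemma aug_boundary_cone_frag_of:
  assumes x: "x \<in> X" and s: "s \<in> insert {} (order_complex r (underS r x))"
  shows "aug_boundary r (frag_of (insert x s))
    = cone x (aug_boundary r (frag_of s)) + frag_cmul ((-1) ^ card s) (frag_of s)"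
proof -
  have xs: "x \<notin> s" "finite s"
    using insert_chain[OF assms] by auto
  have lt: "v \<in> underS r x" if "v \<in> s" for v
    using that s by (auto simp: order_complex_def)
  have 1: "insert x s \<inter> underS r x = s"
    using lt xs by (auto simp: underS_def)
  have 2: "insert x s \<inter> underS r v = s \<inter> underS r v" "insert x s - {v} = insert x (s - {v})" if "v \<in> s" for v
    using lt[OF that] that xs antisym by (auto simp: underS_def)
  have "cone x (aug_boundary r (frag_of s))
      = (\<Sum>v\<in>s. cone x (frag_cmul ((-1) ^ card (s \<inter> underS r v)) (frag_of (s - {v}))))"
    using xs by (simp add: cone_def frag_extend_sum del: frag_extend_of)
  also have "\<dots> = (\<Sum>v\<in>s. frag_cmul ((-1) ^ card (insert x s \<inter> underS r v)) (frag_of (insert x s - {v})))"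
    by (intro sum.cong) (simp_all add: cone_cmul 2)
  finally show ?thesis
    using xs by (simp add: 1)
qed

text \<open>\<open>nat (p + 1)\<close> is the number of vertices of a simplex of dimension
  \<open>p\<close>. In dimension -1 the formula says that the vertex \<open>x\<close> has the empty
  simplex as its boundary.\<close>

lemma aug_boundary_cone:
  assumes x: "x \<in> X" and c: "c \<in> aug_chains r (underS r x) p"
  shows "aug_boundary r (cone x c) = cone x (aug_boundary r c) + frag_cmul ((-1) ^ nat (p + 1)) c"
proof (rule frag_additive_eqI[OF c[unfolded aug_chains_def mem_Collect_eq]])
  fix s assume s: "s \<in> {s \<in> insert {} (order_complex r (underS r x)). int (card s) = p + 1}"
  then have "nat (p + 1) = card s"
    by (metis (lifting) mem_Collect_eq nat_int)
  then show "aug_boundary r (cone x (frag_of s))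
    = cone x (aug_boundary r (frag_of s)) + frag_cmul ((-1) ^ nat (p + 1)) (frag_of s)"
    using s by (simp only: aug_boundary_cone_frag_of[OF x] frag_of_simps(2) mem_Collect_eq)
qed (simp_all add: aug_boundary_diff cone_diff frag_cmul_diff)

lemma chain_has_top:
  assumes "s \<in> order_complex r Y"
  obtains x where "x \<in> s" "s - {x} \<in> insert {} (order_complex r (underS r x))" "x \<in> X"
proof -
  have "finite s" "s \<noteq> {}" "s \<in> Chains r"
    using assms by (auto simp: order_complex_def)
  then have "\<exists>x\<in>s. \<forall>y\<in>s. (y, x) \<in> r"
  proof (induction s rule: finite_ne_induct)
    case (singleton x)
    then show ?case
      by (auto simp: Chains_def)
  next
    case (insert z s)
    then have "s \<in> Chains r"
      by (auto simp: Chains_def)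
    then obtain x where x: "x \<in> s" "\<forall>y\<in>s. (y, x) \<in> r"
      using insert.IH by blast
    have "(z, z) \<in> r" "(x, z) \<in> r \<or> (z, x) \<in> r"
      using insert.prems x(1) by (auto simp: Chains_def)
    then show ?case
      using x trans by blast
  qed
  then obtain x where x: "x \<in> s" "\<forall>y\<in>s. (y, x) \<in> r"
    by blast
  have "s - {x} \<in> insert {} (order_complex r (underS r x))"
    using x(2) assms by (auto simp: order_complex_def Chains_def underS_def)
  moreover have "x \<in> X"
    using x rel_in by blast
  ultimately show thesis
    using that x(1) by blast
qed

text \<open>Every nonempty chain is a cone over the chain \<open>t\<close> below its top. Applying
  the cone formula twice leaves the cone over the double boundary of \<open>t\<close>, zero by
  induction, and two copies of the boundary of \<open>t\<close> with opposite signs; faces need not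
  be paired.\<close>

lemma aug_boundary_aug_boundary_frag_of:
  assumes "s \<in> insert {} (order_complex r Y)"
  shows "aug_boundary r (aug_boundary r (frag_of s)) = 0"
  using assms
proof (induction "card s" arbitrary: s Y rule: less_induct)
  case less
  show ?case
  proof (cases "s = {}")
    case False
    then have "s \<in> order_complex r Y"
      using less.prems by simp
    then obtain x where x: "x \<in> s" "s - {x} \<in> insert {} (order_complex r (underS r x))" "x \<in> X"
      by (rule chain_has_top)
    define t where "t = s - {x}"
    have s: "s = insert x t" and t: "t \<in> insert {} (order_complex r (underS r x))" and fin: "finite s"
      using x less.prems by (auto simp: t_def order_complex_def)
    have "card t < card s"
      using fin x(1) unfolding t_def by (rule card_Diff1_less)
    then have IH: "aug_boundary r (aug_boundary r (frag_of t)) = 0"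
      using less.hyps t by blast
    have "frag_of t \<in> aug_chains r (underS r x) (int (card t) - 1)"
      using t by (simp add: aug_chains_def)
    then have Dt: "aug_boundary r (frag_of t) \<in> aug_chains r (underS r x) (int (card t) - 1 - 1)"
      by (rule aug_boundary_closed)
    have "aug_boundary r (cone x (aug_boundary r (frag_of t)))
        = frag_cmul ((-1) ^ nat (int (card t) - 1 - 1 + 1)) (aug_boundary r (frag_of t))"
      unfolding aug_boundary_cone[OF x(3) Dt] by (simp only: IH boundary_zero add_0)
    also have "\<dots> = frag_cmul (- ((-1) ^ card t)) (aug_boundary r (frag_of t))"
    \<comment> \<open>For empty \<open>t\<close>, \<open>nat\<close> truncates the exponent and the
      two signs disagree, but the boundary of \<open>t\<close> is 0.\<close>
    proof (cases "t = {}")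
      case False
      then obtain n where "card t = Suc n"
        using t by (metis card_gt_0_iff gr0_implies_Suc insert_chain(2) x(3))
      then show ?thesis
        by simp
    qed simp
    finally have "aug_boundary r (cone x (aug_boundary r (frag_of t)))
      = frag_cmul (- ((-1) ^ card t)) (aug_boundary r (frag_of t))" .
    then show ?thesis
      unfolding s aug_boundary_cone_frag_of[OF x(3) t] aug_boundary_add aug_boundary_cmul
      by (simp only: flip: frag_cmul_distrib) simp
  qed simp
qed

lemma aug_boundary_aug_boundary:
  assumes "c \<in> aug_chains r Y p"
  shows "aug_boundary r (aug_boundary r c) = 0"
proof (rule frag_additive_eqI[OF assms[unfolded aug_chains_def mem_Collect_eq]])
  show "aug_boundary r (aug_boundary r (frag_of s)) = 0"
    if "s \<in> {s \<in> insert {} (order_complex r Y). int (card s) = p + 1}" for s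
    using that by (intro aug_boundary_aug_boundary_frag_of) auto
qed (simp_all add: aug_boundary_diff)

lemma poset_boundary_poset_boundary:
  assumes "c \<in> poset_chains r Y p"
  shows "poset_boundary r (poset_boundary r c) = 0"
  using aug_boundary_aug_boundary[of c Y p] assms poset_chains_subset_aug_chains[of r Y p]
  by (auto simp: poset_boundary_def aug_boundary_drop_empty)

lemma cone_closed:
  assumes "x \<in> X" "underS r x \<inter> Z \<union> {x} \<subseteq> Y" "c \<in> aug_chains r (underS r x \<inter> Z) p"
  shows "cone x c \<in> poset_chains r Y (p + 1)"
  unfolding cone_def poset_chains_def mem_Collect_eq
proof (rule frag_extend_mem_keys[OF assms(3)[unfolded aug_chains_def mem_Collect_eq]])
  fix s assume s: "s \<in> {s \<in> insert {} (order_complex r (underS r x \<inter> Z)). int (card s) = p + 1}"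
  then have s': "s \<in> insert {} (order_complex r (underS r x))" "s \<subseteq> underS r x \<inter> Z"
    by (auto simp: order_complex_def)
  have "insert x s \<in> order_complex r Y"
    using insert_chain[OF assms(1) s'(1)] s'(2) assms(2) by (auto simp: order_complex_def)
  then show "Poly_Mapping.keys (frag_of (insert x s)) \<subseteq> {s \<in> order_complex r Y. int (card s) = p + 1 + 1}"
    using insert_chain[OF assms(1) s'(1)] s by simp
qed

lemma poset_boundary_cone:
  assumes "x \<in> X" "c \<in> aug_chains r (underS r x) p"
  shows "poset_boundary r (cone x c)
    = cone x (aug_boundary r c) + frag_cmul ((-1) ^ nat (p + 1)) (drop_empty c)"
proof -
  have "cone x (aug_boundary r c) \<in> poset_chains r X (p - 1 + 1)"
    using assms underS_subset aug_boundary_closed[OF assms(2)]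
    by (intro cone_closed[where Z = UNIV]) auto
  then show ?thesis
    unfolding poset_boundary_def aug_boundary_cone[OF assms] drop_empty_add drop_empty_cmul
    by (simp add: drop_empty_id)
qed

text \<open>By maximality of \<open>x\<close> in \<open>Y\<close>, a simplex through
  \<open>x\<close> has \<open>x\<close> as its top vertex, hence is a cone over a chain strictly
  below \<open>x\<close>; \<open>cone x c1\<close> collects these simplices.\<close>

lemma cone_decomposition:
  assumes x: "x \<in> X" "x \<in> Y" "\<And>y. y \<in> Y \<Longrightarrow> (x, y) \<in> r \<Longrightarrow> y = x"
    and c: "c \<in> poset_chains r Y p"
  obtains c1 c0 where "c1 \<in> aug_chains r (underS r x \<inter> Y) (p - 1)" "c0 \<in> poset_chains r (Y - {x}) p"
    "c = cone x c1 + c0"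
proof -
  define S where "S = {s \<in> order_complex r Y. int (card s) = p + 1}"
  have "Poly_Mapping.keys c \<subseteq> {s \<in> S. x \<in> s} \<union> {s \<in> S. x \<notin> s}"
    using c by (auto simp: poset_chains_def S_def)
  then obtain a b where ab: "Poly_Mapping.keys a \<subseteq> {s \<in> S. x \<in> s}"
    "Poly_Mapping.keys b \<subseteq> {s \<in> S. x \<notin> s}" "a + b = c"
    by (rule frag_split)
  have "b \<in> poset_chains r (Y - {x}) p"
    using ab(2) by (auto simp: poset_chains_def S_def order_complex_def)
  moreover define c1 where "c1 = frag_extend (\<lambda>s. frag_of (s - {x})) a"
  have "c1 \<in> aug_chains r (underS r x \<inter> Y) (p - 1)"
    unfolding c1_def aug_chains_def mem_Collect_eq
  proof (rule frag_extend_mem_keys[OF ab(1)])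
    fix s assume s: "s \<in> {s \<in> S. x \<in> s}"
    then have sY: "finite s" "s \<subseteq> Y" "s \<in> Chains r" "x \<in> s" "int (card s) = p + 1"
      by (auto simp: S_def order_complex_def)
    have "y \<in> underS r x" if "y \<in> s - {x}" for y
      using that sY x(3)[of y] by (auto simp: underS_def Chains_def)
    then have "s - {x} \<in> insert {} (order_complex r (underS r x \<inter> Y))"
      using sY by (auto simp: order_complex_def Chains_def)
    moreover have "Suc (card (s - {x})) = card s"
      using sY by (intro card_Suc_Diff1)
    ultimately show "Poly_Mapping.keys (frag_of (s - {x}))
      \<subseteq> {s \<in> insert {} (order_complex r (underS r x \<inter> Y)). int (card s) = p - 1 + 1}"
      using sY(5) by simp
  qed
  moreover have "cone x c1 = a"
    unfolding c1_def
    by (rule frag_additive_eqI[where g = "\<lambda>c. c", OF ab(1)])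
       (auto simp: cone_diff frag_extend_diff insert_absorb)
  then have "c = cone x c1 + b"
    using ab(3) by simp
  ultimately show thesis
    using that by blast
qed

text \<open>Deleting \<open>x\<close> from the simplices that contain it and killing all others is a
  left inverse of \<open>cone x\<close> and vanishes on chains of \<open>Z\<close>. The lemma serves
  to compare the parts through \<open>x\<close> in an equation, with \<open>b\<close> collecting the
  rest.\<close>

lemma cone_eq_zero:
  assumes c: "c \<in> aug_chains r (underS r x) p" and Z: "x \<notin> Z"
    and mem: "cone x c + b \<in> poset_chains r Z q" and b: "b \<in> poset_chains r Z q"
  shows "c = 0"
proof -
  have "frag_extend (\<lambda>t. if x \<in> t then frag_of (t - {x}) else 0) (cone x c) = c"
  proof (rule frag_additive_eqI[where g = "\<lambda>c. c", OF c[unfolded aug_chains_def mem_Collect_eq]])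
    fix s assume "s \<in> {s \<in> insert {} (order_complex r (underS r x)). int (card s) = p + 1}"
    then have "x \<notin> s"
      by (auto simp: order_complex_def underS_def)
    then show "frag_extend (\<lambda>t. if x \<in> t then frag_of (t - {x}) else 0) (cone x (frag_of s)) = frag_of s"
      by simp
  qed (simp_all add: cone_diff frag_extend_diff)
  moreover have "cone x c = (cone x c + b) - b"
    by simp
  then have "cone x c \<in> poset_chains r Z q"
    using poset_chains_closed(2)[OF mem b] by simp
  then have "frag_extend (\<lambda>t. if x \<in> t then frag_of (t - {x}) else 0) (cone x c) = 0"
    using Z by (intro frag_extend_eq_0) (auto simp: poset_chains_def order_complex_def)
  ultimately show ?thesis
    by simp
qed

end

section \<open>Homology in terms of chains\<close>

text \<open>The differential is one map for all degrees, so homology equals this quotient literally,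
  not just up to isomorphism. It serves the two simplicial complexes and the complex on critical
  points alike.\<close>

lemma chain_homology_free_Abelian_group:
  assumes diff: "\<And>a b. \<delta> (a - b) = \<delta> a - \<delta> b"
    and closed: "\<And>q c. Poly_Mapping.keys c \<subseteq> A q \<Longrightarrow> Poly_Mapping.keys (\<delta> c) \<subseteq> A (q - 1)"
  shows "chain_homology (\<lambda>q. free_Abelian_group (A q)) (\<lambda>_. \<delta>) p
    = frag_group {c. Poly_Mapping.keys c \<subseteq> A p \<and> \<delta> c = 0} Mod \<delta> ` {c. Poly_Mapping.keys c \<subseteq> A (p + 1)}"
proof -
  let ?Z = "{c. Poly_Mapping.keys c \<subseteq> A p \<and> \<delta> c = 0}"
  have FA: "free_Abelian_group (A p) = frag_group {c. Poly_Mapping.keys c \<subseteq> A p}"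
    by (simp add: free_Abelian_group_def frag_group_def)
  have "\<delta> 0 = 0"
    using diff[of 0 0] by simp
  then have "frag_subgroup ?Z"
    unfolding frag_subgroup_def using diff keys_diff by fastforce
  then interpret Z: subgroup ?Z "free_Abelian_group (A p)"
    unfolding FA by (subst subgroup_frag_group_iff[OF frag_subgroup_keys]) auto
  have "kernel (free_Abelian_group (A p)) (free_Abelian_group (A (p - 1))) \<delta> = ?Z"
    by (auto simp: kernel_def)
  moreover have "subgroup_generated (free_Abelian_group (A p)) ?Z = frag_group ?Z"
    using Z.carrier_subgroup_generated_subgroup
    by (simp add: subgroup_generated_def frag_group_def free_Abelian_group_def)
  moreover have "carrier (free_Abelian_group (A (p + 1))) = {c. Poly_Mapping.keys c \<subseteq> A (p + 1)}"
    by auto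
  ultimately show ?thesis
    by (simp add: chain_homology_def)
qed

context finite_poset begin

lemma reduced_poset_homology_eq:
  "reduced_poset_homology r Y p = frag_group {c \<in> aug_chains r Y p. aug_boundary r c = 0}
     Mod aug_boundary r ` aug_chains r Y (p + 1)"
proof -
  let ?A = "\<lambda>q. {s \<in> insert {} (order_complex r Y). int (card s) = q + 1}"
  let ?\<delta> = "simplicial_boundary r (insert {} (order_complex r Y))"
  have eq: "?\<delta> c = aug_boundary r c" if "c \<in> aug_chains r Y q" for c q
    using that by (rule reduced_simplicial_boundary_eq)
  have diff: "?\<delta> (a - b) = ?\<delta> a - ?\<delta> b" for a b
    by (simp add: simplicial_boundary_def frag_extend_diff)
  have closed: "Poly_Mapping.keys (?\<delta> c) \<subseteq> ?A (q - 1)" if "Poly_Mapping.keys c \<subseteq> ?A q" for q c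
  proof -
    have c: "c \<in> aug_chains r Y q"
      using that by (simp only: aug_chains_def mem_Collect_eq)
    show ?thesis
      using aug_boundary_closed[OF c] by (simp only: eq[OF c] aug_chains_def mem_Collect_eq)
  qed
  have "{c. Poly_Mapping.keys c \<subseteq> ?A p \<and> ?\<delta> c = 0} = {c \<in> aug_chains r Y p. aug_boundary r c = 0}"
    using eq by (auto simp: aug_chains_def)
  moreover have "{c. Poly_Mapping.keys c \<subseteq> ?A (p + 1)} = aug_chains r Y (p + 1)"
    by (simp only: aug_chains_def)
  then have "?\<delta> ` {c. Poly_Mapping.keys c \<subseteq> ?A (p + 1)} = aug_boundary r ` aug_chains r Y (p + 1)"
    by (rule image_cong) (rule eq)
  moreover have "reduced_poset_homology r Y p
    = frag_group {c. Poly_Mapping.keys c \<subseteq> ?A p \<and> ?\<delta> c = 0} Mod ?\<delta> ` {c. Poly_Mapping.keys c \<subseteq> ?A (p + 1)}"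
    unfolding reduced_poset_homology_def simplicial_homology_def simplicial_chain_group_def[abs_def]
    by (rule chain_homology_free_Abelian_group[where A = ?A, OF diff closed])
  ultimately show ?thesis
    by (simp only:)
qed

lemma poset_homology_eq:
  "poset_homology r Y p = frag_group {c \<in> poset_chains r Y p. poset_boundary r c = 0}
     Mod poset_boundary r ` poset_chains r Y (p + 1)"
proof -
  let ?A = "\<lambda>q. {s \<in> order_complex r Y. int (card s) = q + 1}"
  let ?\<delta> = "simplicial_boundary r (order_complex r Y)"
  have eq: "?\<delta> c = poset_boundary r c" if "c \<in> poset_chains r Y q" for c q
    using that by (rule simplicial_boundary_eq)
  have diff: "?\<delta> (a - b) = ?\<delta> a - ?\<delta> b" for a b
    by (simp add: simplicial_boundary_def frag_extend_diff)
  have closed: "Poly_Mapping.keys (?\<delta> c) \<subseteq> ?A (q - 1)" if "Poly_Mapping.keys c \<subseteq> ?A q" for q c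
  proof -
    have c: "c \<in> poset_chains r Y q"
      using that by (simp only: poset_chains_def mem_Collect_eq)
    show ?thesis
      using poset_boundary_closed[OF c] by (simp only: eq[OF c] poset_chains_def mem_Collect_eq)
  qed
  have "{c. Poly_Mapping.keys c \<subseteq> ?A p \<and> ?\<delta> c = 0} = {c \<in> poset_chains r Y p. poset_boundary r c = 0}"
    using eq by (auto simp: poset_chains_def)
  moreover have "{c. Poly_Mapping.keys c \<subseteq> ?A (p + 1)} = poset_chains r Y (p + 1)"
    by (simp only: poset_chains_def)
  then have "?\<delta> ` {c. Poly_Mapping.keys c \<subseteq> ?A (p + 1)} = poset_boundary r ` poset_chains r Y (p + 1)"
    by (rule image_cong) (rule eq)
  moreover have "poset_homology r Y p
    = frag_group {c. Poly_Mapping.keys c \<subseteq> ?A p \<and> ?\<delta> c = 0} Mod ?\<delta> ` {c. Poly_Mapping.keys c \<subseteq> ?A (p + 1)}"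
    unfolding poset_homology_def simplicial_homology_def simplicial_chain_group_def[abs_def]
    by (rule chain_homology_free_Abelian_group[where A = ?A, OF diff closed])
  ultimately show ?thesis
    by (simp only:)
qed

lemma frag_subgroup_aug_cycles: "frag_subgroup {c \<in> aug_chains r Y p. aug_boundary r c = 0}"
  and frag_subgroup_poset_cycles: "frag_subgroup {c \<in> poset_chains r Y p. poset_boundary r c = 0}"
  by (auto simp: frag_subgroup_def aug_chains_closed poset_chains_closed aug_boundary_diff poset_boundary_diff)

lemma subgroup_aug_boundaries:
  "subgroup (aug_boundary r ` aug_chains r Y (p + 1))
     (frag_group {c \<in> aug_chains r Y p. aug_boundary r c = 0})"
proof (subst subgroup_frag_group_iff[OF frag_subgroup_aug_cycles], intro conjI)
  show "aug_boundary r ` aug_chains r Y (p + 1) \<subseteq> {c \<in> aug_chains r Y p. aug_boundary r c = 0}"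
    using aug_boundary_closed[of _ r Y "p + 1"] aug_boundary_aug_boundary by auto
  show "frag_subgroup (aug_boundary r ` aug_chains r Y (p + 1))"
    using frag_subgroup_aug_chains aug_boundary_diff by (rule frag_subgroup_image)
qed

lemma trivial_reduced_homologyD:
  assumes "trivial_group (reduced_poset_homology r Y p)" "c \<in> aug_chains r Y p" "aug_boundary r c = 0"
  obtains u where "u \<in> aug_chains r Y (p + 1)" "c = aug_boundary r u"
proof -
  have "{c \<in> aug_chains r Y p. aug_boundary r c = 0} \<subseteq> aug_boundary r ` aug_chains r Y (p + 1)"
    using comm_group.trivial_Mod_imp_subset[OF comm_group_frag_group[OF frag_subgroup_aug_cycles]
        subgroup_aug_boundaries] assms(1)
    by (simp add: reduced_poset_homology_eq)
  then show thesis
    using assms(2,3) that by blast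
qed

lemma integer_reduced_homologyD:
  assumes "reduced_poset_homology r Y p \<cong> integer_group"
  obtains z where "z \<in> aug_chains r Y p" "aug_boundary r z = 0"
    "\<And>c. c \<in> aug_chains r Y p \<Longrightarrow> aug_boundary r c = 0 \<Longrightarrow>
       \<exists>n. \<exists>u\<in>aug_chains r Y (p + 1). c = frag_cmul n z + aug_boundary r u"
    "\<And>n u. u \<in> aug_chains r Y (p + 1) \<Longrightarrow> frag_cmul n z = aug_boundary r u \<Longrightarrow> n = 0"
proof -
  let ?Z = "{c \<in> aug_chains r Y p. aug_boundary r c = 0}"
  let ?B = "aug_boundary r ` aug_chains r Y (p + 1)"
  have "frag_group ?Z Mod ?B \<cong> integer_group"
    using assms by (simp only: reduced_poset_homology_eq)
  from comm_group.Mod_iso_integer_group_imp[OF comm_group_frag_group[OF frag_subgroup_aug_cycles]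
      subgroup_aug_boundaries this]
  obtain z where z: "z \<in> carrier (frag_group ?Z)"
    "\<And>c. c \<in> carrier (frag_group ?Z) \<Longrightarrow>
       \<exists>n::int. c \<otimes>\<^bsub>frag_group ?Z\<^esub> inv\<^bsub>frag_group ?Z\<^esub> (z [^]\<^bsub>frag_group ?Z\<^esub> n) \<in> ?B"
    "\<And>n::int. z [^]\<^bsub>frag_group ?Z\<^esub> n \<in> ?B \<Longrightarrow> n = 0"
    by blast
  have zZ: "z \<in> ?Z"
    using z(1) by simp
  have pow: "z [^]\<^bsub>frag_group ?Z\<^esub> n = frag_cmul n z" for n :: int
    using int_pow_frag_group[OF frag_subgroup_aug_cycles zZ] .
  have inv: "inv\<^bsub>frag_group ?Z\<^esub> (z [^]\<^bsub>frag_group ?Z\<^esub> n) = - frag_cmul n z" for n :: int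
    unfolding pow by (intro inv_frag_group frag_subgroup_aug_cycles frag_subgroup_cmul zZ)
  show thesis
  proof (rule that)
    show "z \<in> aug_chains r Y p" "aug_boundary r z = 0"
      using zZ by auto
    fix c assume "c \<in> aug_chains r Y p" "aug_boundary r c = 0"
    then have "c \<in> carrier (frag_group ?Z)"
      by simp
    from z(2)[OF this]
    obtain n :: int where "c \<otimes>\<^bsub>frag_group ?Z\<^esub> inv\<^bsub>frag_group ?Z\<^esub> (z [^]\<^bsub>frag_group ?Z\<^esub> n) \<in> ?B"
      by blast
    then have "c + - frag_cmul n z \<in> ?B"
      by (simp only: inv frag_group_simps)
    then obtain u where "u \<in> aug_chains r Y (p + 1)" "c + - frag_cmul n z = aug_boundary r u"
      by (rule imageE)
    then have "c = frag_cmul n z + aug_boundary r u"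
      by (metis add.commute add_diff_cancel_right' diff_conv_add_uminus diff_add_cancel)
    then show "\<exists>n. \<exists>u\<in>aug_chains r Y (p + 1). c = frag_cmul n z + aug_boundary r u"
      using \<open>u \<in> aug_chains r Y (p + 1)\<close> by blast
  next
    fix n u assume "u \<in> aug_chains r Y (p + 1)" "frag_cmul n z = aug_boundary r u"
    then have "frag_cmul n z \<in> ?B"
      by simp
    then show "n = 0"
      by (rule z(3)[unfolded pow])
  qed
qed

section \<open>Relative homology of a removed point and of a removed pair\<close>

text \<open>Comparing simplices through \<open>x\<close>, a relative cycle is a cone over a reduced
  cycle of the strict down-set plus a chain avoiding \<open>x\<close>. Coning therefore raises
  dimension by one, and the generator is the cone over the fundamental cycle. For
  \<open>p = 0\<close> that cycle is a multiple of the empty simplex, which the augmented chains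
  provide.\<close>

lemma relative_sphere:
  assumes x: "x \<in> X" "x \<in> Y" "\<And>y. y \<in> Y \<Longrightarrow> (x, y) \<in> r \<Longrightarrow> y = x" "underS r x \<subseteq> Y"
    and sphere: "homology_sphere r (underS r x) (p - 1)"
  obtains z where "z \<in> poset_chains r Y p" "poset_boundary r z \<in> poset_chains r (Y - {x}) (p - 1)"
    "\<And>q c. c \<in> poset_chains r Y q \<Longrightarrow> poset_boundary r c \<in> poset_chains r (Y - {x}) (q - 1) \<Longrightarrow>
       \<exists>n. \<exists>u\<in>poset_chains r Y (q + 1). c - frag_cmul n z - poset_boundary r u \<in> poset_chains r (Y - {x}) q
         \<and> (q \<noteq> p \<longrightarrow> n = 0)"
    "\<And>n u. u \<in> poset_chains r Y (p + 1) \<Longrightarrow>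
       frag_cmul n z - poset_boundary r u \<in> poset_chains r (Y - {x}) p \<Longrightarrow> n = 0"
proof -
  let ?U = "underS r x" and ?Y = "Y - {x}"
  have UY: "?U \<inter> Y = ?U" "?U \<subseteq> ?Y"
    using x(4) by (auto simp: underS_def)
  have cone: "cone x c \<in> poset_chains r Y (q + 1)" if "c \<in> aug_chains r ?U q" for c q
    using cone_closed[of x Y Y c q] that UY(1) x(1,2,4) by auto
  have drop: "frag_cmul k (drop_empty c) \<in> poset_chains r ?Y q" if "c \<in> aug_chains r ?U q" for c q k
    using drop_empty_closed[OF that] poset_chains_mono[OF UY(2)] by (blast intro: poset_chains_closed)
  have decomp: "\<exists>c1\<in>aug_chains r ?U (q - 1). \<exists>c0\<in>poset_chains r ?Y q. c = cone x c1 + c0"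
    if "c \<in> poset_chains r Y q" for c q
    using cone_decomposition[OF x(1-3) that] unfolding UY(1) by metis
  have "reduced_poset_homology r ?U (p - 1) \<cong> integer_group"
    and triv: "\<And>q. q \<noteq> p - 1 \<Longrightarrow> trivial_group (reduced_poset_homology r ?U q)"
    using sphere unfolding homology_sphere_def by metis+
  from integer_reduced_homologyD[OF this(1)]
  obtain z where z: "z \<in> aug_chains r ?U (p - 1)" "aug_boundary r z = 0"
    "\<And>c. c \<in> aug_chains r ?U (p - 1) \<Longrightarrow> aug_boundary r c = 0 \<Longrightarrow>
       \<exists>n. \<exists>u\<in>aug_chains r ?U (p - 1 + 1). c = frag_cmul n z + aug_boundary r u"
    "\<And>n u. u \<in> aug_chains r ?U (p - 1 + 1) \<Longrightarrow> frag_cmul n z = aug_boundary r u \<Longrightarrow> n = 0"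
    by blast
  show thesis
  proof (rule that[of "cone x z"])
    show "cone x z \<in> poset_chains r Y p"
      using cone[OF z(1)] by simp
    show "poset_boundary r (cone x z) \<in> poset_chains r ?Y (p - 1)"
      unfolding poset_boundary_cone[OF x(1) z(1)] z(2) using drop[OF z(1)] by simp
  next
    fix q c assume c: "c \<in> poset_chains r Y q" "poset_boundary r c \<in> poset_chains r ?Y (q - 1)"
    obtain c1 c0 where c1: "c1 \<in> aug_chains r ?U (q - 1)" "c0 \<in> poset_chains r ?Y q" "c = cone x c1 + c0"
      using decomp[OF c(1)] by blast
    \<comment> \<open>The boundary of \<open>c\<close>, sorted into simplices through
      \<open>x\<close> and the others. Both the total and the second part avoid \<open>x\<close>, so
      the first part vanishes.\<close>
    have "cone x (aug_boundary r c1) + (frag_cmul ((-1) ^ nat (q - 1 + 1)) (drop_empty c1) + poset_boundary r c0)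
        \<in> poset_chains r ?Y (q - 1)"
      using c(2) unfolding c1(3) poset_boundary_add poset_boundary_cone[OF x(1) c1(1)] by (simp only: add.assoc)
    then have cyc: "aug_boundary r c1 = 0"
      by (rule cone_eq_zero[OF aug_boundary_closed[OF c1(1)], rotated])
         (auto intro!: poset_chains_closed drop[OF c1(1)] poset_boundary_closed c1(2))
    \<comment> \<open>Unless \<open>q = p\<close>, the cycle \<open>c1\<close> lies in a dimension
      without reduced homology, hence bounds, and \<open>n\<close> is 0.\<close>
    obtain n u where u: "u \<in> aug_chains r ?U q" "c1 = frag_cmul n z + aug_boundary r u" "q \<noteq> p \<longrightarrow> n = 0"
    proof (cases "q = p")
      case True
      then show thesis
        using z(3)[of c1] c1(1) cyc that by auto
    next
      case False
      then have "q - 1 \<noteq> p - 1"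
        by simp
      from trivial_reduced_homologyD[OF triv[OF this] c1(1) cyc] show thesis
        using that[of _ 0] by auto
    qed
    have "c - frag_cmul n (cone x z) - poset_boundary r (cone x u)
      = c0 - frag_cmul ((-1) ^ nat (q + 1)) (drop_empty u)"
      unfolding c1(3) u(2) poset_boundary_cone[OF x(1) u(1)] cone_add cone_cmul by simp
    also have "\<dots> \<in> poset_chains r ?Y q"
      by (intro poset_chains_closed(2) c1(2) drop[OF u(1)])
    finally show "\<exists>n. \<exists>u\<in>poset_chains r Y (q + 1).
        c - frag_cmul n (cone x z) - poset_boundary r u \<in> poset_chains r ?Y q \<and> (q \<noteq> p \<longrightarrow> n = 0)"
      using cone[OF u(1)] u(3) by blast
  next
    fix n u assume u: "u \<in> poset_chains r Y (p + 1)"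
      "frag_cmul n (cone x z) - poset_boundary r u \<in> poset_chains r ?Y p"
    obtain u1 u0 where u1: "u1 \<in> aug_chains r ?U (p + 1 - 1)" "u0 \<in> poset_chains r ?Y (p + 1)" "u = cone x u1 + u0"
      using decomp[OF u(1)] by blast
    \<comment> \<open>All terms of the difference in which \<open>x\<close> does not occur.\<close>
    let ?b = "- frag_cmul ((-1) ^ nat (p + 1 - 1 + 1)) (drop_empty u1) - poset_boundary r u0"
    have b: "?b \<in> poset_chains r ?Y p"
    proof (intro poset_chains_closed(2,3))
      show "frag_cmul ((-1) ^ nat (p + 1 - 1 + 1)) (drop_empty u1) \<in> poset_chains r ?Y p"
        using drop[OF u1(1)] by simp
      show "poset_boundary r u0 \<in> poset_chains r ?Y p"
        using poset_boundary_closed[OF u1(2)] by simp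
    qed
    have "cone x (frag_cmul n z - aug_boundary r u1) + ?b \<in> poset_chains r ?Y p"
      using u(2) unfolding u1(3) poset_boundary_add poset_boundary_cone[OF x(1) u1(1)] cone_diff cone_cmul
      by (simp add: algebra_simps del: minus_frag_cmul)
    moreover have "frag_cmul n z - aug_boundary r u1 \<in> aug_chains r ?U (p - 1)"
      using z(1) aug_boundary_closed[OF u1(1)] by (intro aug_chains_closed) simp_all
    ultimately have "frag_cmul n z - aug_boundary r u1 = 0"
      using b by (intro cone_eq_zero[where Z = ?Y and b = ?b]) auto
    then show "n = 0"
      using z(4)[of u1 n] u1(1) by simp
  qed
qed

text \<open>A relative cycle splits into simplices through \<open>x\<close>, through
  \<open>w\<close> but not \<open>x\<close>, and through neither. The boundary of a double cone
  trades the middle part for cones from \<open>x\<close>. What is then coned from \<open>x\<close>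
  is a reduced cycle that avoids \<open>w\<close>, and acyclicity makes it a boundary.\<close>

lemma relative_pair:
  assumes x: "x \<in> X" "x \<in> Y" "\<And>y. y \<in> Y \<Longrightarrow> (x, y) \<in> r \<Longrightarrow> y = x" "underS r x \<subseteq> Y"
    and w: "w \<in> underS r x" "\<And>y. y \<in> Y \<Longrightarrow> (w, y) \<in> r \<Longrightarrow> y = w \<or> y = x" "underS r w \<subseteq> Y"
    and acyclic: "acyclic_poset r (underS r x - {w})"
    and c: "c \<in> poset_chains r Y q" "poset_boundary r c \<in> poset_chains r (Y - {w, x}) (q - 1)"
  shows "\<exists>u\<in>poset_chains r Y (q + 1). c - poset_boundary r u \<in> poset_chains r (Y - {w, x}) q"
proof -
  let ?U = "underS r x" and ?W = "underS r w" and ?Y = "Y - {w, x}"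
  have wx: "w \<in> X" "w \<noteq> x" "(w, x) \<in> r"
    using w(1) rel_in by (auto simp: underS_def)
  have sub: "?U \<inter> Y = ?U" "?W \<inter> (Y - {x}) = ?W" "?W \<union> {w} \<subseteq> ?U" "?U - {w} \<subseteq> ?Y" "Y - {x} - {w} = ?Y"
    using x(4) w(1,3) wx trans[of _ w x] antisym[of w x] by (auto simp: underS_def)
  have coneU: "cone x c \<in> poset_chains r Y (q + 1)" if "c \<in> aug_chains r ?U q" for c q
    using cone_closed[of x Y Y c q] that sub(1) x(1,2,4) by auto
  have coneW: "cone w c \<in> poset_chains r ?U (q + 1)" if "c \<in> aug_chains r ?W q" for c q
    using cone_closed[of w UNIV ?U c q] that sub(3) wx(1) by auto
  obtain c1 c0 where c1: "c1 \<in> aug_chains r ?U (q - 1)" "c0 \<in> poset_chains r (Y - {x}) q" "c = cone x c1 + c0"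
    using cone_decomposition[OF x(1-3) c(1)] unfolding sub(1) by metis
  have wmax: "y = w" if "y \<in> Y - {x}" "(w, y) \<in> r" for y
    using w(2) that by blast
  have "w \<in> Y - {x}"
    using w(1) x(4) wx(2) by blast
  then obtain a c00 where a: "a \<in> aug_chains r ?W (q - 1)" "c00 \<in> poset_chains r ?Y q" "c0 = cone w a + c00"
    using cone_decomposition[OF wx(1) _ wmax c1(2)] unfolding sub(2,5) by metis
  define \<epsilon> :: int where "\<epsilon> = (-1) ^ nat (q + 1)"
  have \<epsilon>: "\<epsilon> * \<epsilon> = 1"
    by (simp add: \<epsilon>_def flip: power_mult_distrib)
  have wa: "cone w a \<in> poset_chains r ?U q"
    using coneW[OF a(1)] by simp
  then have wa': "cone w a \<in> aug_chains r ?U q"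
    using poset_chains_subset_aug_chains by blast
  \<comment> \<open>Subtracting the boundary of \<open>u1\<close> cancels \<open>cone w a\<close>
    and leaves \<open>G\<close> as the base of the cone from \<open>x\<close>. The sign
    \<open>\<epsilon>\<close> is that of the face opposite \<open>x\<close>; putting it into
    \<open>u1\<close> gives \<open>cone w a\<close> the coefficient 1.\<close>
  define G where "G = c1 - frag_cmul \<epsilon> (aug_boundary r (cone w a))"
  have G: "G \<in> aug_chains r ?U (q - 1)"
    unfolding G_def by (intro aug_chains_closed c1(1) aug_boundary_closed wa')
  define u1 where "u1 = frag_cmul \<epsilon> (cone x (cone w a))"
  have u1: "u1 \<in> poset_chains r Y (q + 1)"
    unfolding u1_def by (intro poset_chains_closed coneU wa')
  have c': "c - poset_boundary r u1 = cone x G + c00"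
    unfolding u1_def poset_boundary_cmul poset_boundary_cone[OF x(1) wa', folded \<epsilon>_def]
      drop_empty_id[OF wa] G_def c1(3) a(3) cone_diff cone_cmul
    by (simp add: frag_cmul_distrib2 \<epsilon>)
  have "poset_boundary r (cone x G + c00) = poset_boundary r c"
    unfolding c'[symmetric] poset_boundary_diff poset_boundary_poset_boundary[OF u1] by simp
  then have bd: "cone x (aug_boundary r G) + (frag_cmul ((-1) ^ nat (q - 1 + 1)) (drop_empty G)
      + poset_boundary r c00) \<in> poset_chains r ?Y (q - 1)"
    using c(2) unfolding poset_boundary_add poset_boundary_cone[OF x(1) G] by (simp add: add.assoc)
  have dropU: "drop_empty G \<in> poset_chains r ?U (q - 1)"
    using drop_empty_closed[OF G] .
  have UY: "?U \<subseteq> Y - {x}"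
    using x(4) by (auto simp: underS_def)
  have 0: "aug_boundary r G = 0"
  proof (rule cone_eq_zero[OF aug_boundary_closed[OF G], of "Y - {x}"])
    show "cone x (aug_boundary r G) + (frag_cmul ((-1) ^ nat (q - 1 + 1)) (drop_empty G)
      + poset_boundary r c00) \<in> poset_chains r (Y - {x}) (q - 1)"
      using bd poset_chains_mono[of ?Y "Y - {x}"] by blast
    have "poset_boundary r c00 \<in> poset_chains r (Y - {x}) (q - 1)"
      using poset_boundary_closed[OF a(2)] poset_chains_mono[of ?Y "Y - {x}"] by blast
    then show "frag_cmul ((-1) ^ nat (q - 1 + 1)) (drop_empty G) + poset_boundary r c00
        \<in> poset_chains r (Y - {x}) (q - 1)"
      using dropU poset_chains_mono[OF UY] by (intro poset_chains_closed) blast+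
  qed simp
  \<comment> \<open>Now that \<open>G\<close> is a cycle, only its copy as the face opposite
    \<open>x\<close> is left besides a chain of \<open>?Y\<close>. As the whole lies in
    \<open>?Y\<close>, no simplex of \<open>G\<close> contains \<open>w\<close>.\<close>
  have "frag_cmul ((-1) ^ nat q) (drop_empty G) + poset_boundary r c00 \<in> poset_chains r ?Y (q - 1)"
    using bd by (simp add: 0)
  from poset_chains_closed(2)[OF this poset_boundary_closed[OF a(2)]]
  have "frag_cmul ((-1) ^ nat q) (drop_empty G) \<in> poset_chains r ?Y (q - 1)"
    by (simp only: add_diff_cancel_right')
  from poset_chains_closed(5)[OF this]
  have "frag_cmul ((-1) ^ nat q) (frag_cmul ((-1) ^ nat q) (drop_empty G)) \<in> poset_chains r ?Y (q - 1)" .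
  moreover have "(-1) ^ nat q * (-1) ^ nat q = (1 :: int)"
    by (simp flip: power_mult_distrib)
  ultimately have dropY: "drop_empty G \<in> poset_chains r ?Y (q - 1)"
    by (simp only: frag_cmul_cmul frag_cmul_one)
  \<comment> \<open>\<open>drop_empty G\<close> says nothing about the empty simplex, which belongs
    to every augmented complex and is treated apart.\<close>
  have "s \<in> {s \<in> insert {} (order_complex r (?U - {w})). int (card s) = q - 1 + 1}" if s: "s \<in> Poly_Mapping.keys G" for s
  proof (cases "s = {}")
    case True
    then show ?thesis
      using s G by (auto simp: aug_chains_def)
  next
    case False
    have "Poly_Mapping.lookup (drop_empty G) s = Poly_Mapping.lookup G s"
      by (rule frag_additive_eqI[where S = UNIV and f = "\<lambda>G. Poly_Mapping.lookup (drop_empty G) s"])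
         (use False in \<open>auto simp: drop_empty_diff lookup_minus lookup_single\<close>)
    then have "s \<in> Poly_Mapping.keys (drop_empty G)"
      using s by (simp add: in_keys_iff)
    then have "s \<in> order_complex r ?Y" "s \<in> order_complex r ?U" "int (card s) = q - 1 + 1"
      using dropY dropU by (auto simp: poset_chains_def)
    then show ?thesis
      by (auto simp: order_complex_def)
  qed
  then have G': "G \<in> aug_chains r (?U - {w}) (q - 1)"
    unfolding aug_chains_def by blast
  have "trivial_group (reduced_poset_homology r (?U - {w}) (q - 1))"
    using acyclic by (simp add: acyclic_poset_def)
  then obtain H where H: "H \<in> aug_chains r (?U - {w}) q" "G = aug_boundary r H"
    using trivial_reduced_homologyD[OF _ G' 0] by (metis diff_add_cancel)
  have H': "H \<in> aug_chains r ?U q"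
    using H(1) aug_chains_mono[of "?U - {w}" ?U] by blast
  have "c - poset_boundary r (u1 + cone x H) = c00 - frag_cmul \<epsilon> (drop_empty H)"
    using c' unfolding poset_boundary_add poset_boundary_cone[OF x(1) H', folded \<epsilon>_def] H(2)
    by (simp add: algebra_simps)
  also have "\<dots> \<in> poset_chains r ?Y q"
    using drop_empty_closed[OF H(1)] poset_chains_mono[OF sub(4)] a(2)
    by (intro poset_chains_closed) blast+
  finally show ?thesis
    using poset_chains_closed(4)[OF u1 coneU[OF H']] by blast
qed

end

section \<open>Models on the critical points\<close>

text \<open>A quasi-isomorphism given on generators: \<open>g\<close> extends to the differential of
  the free complex on the sets \<open>E p\<close>, \<open>h\<close> to a chain map into the chains
  of \<open>Y\<close>. The second clause is surjectivity on homology and the third is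
  injectivity.\<close>

definition morse_model ::
    "'a rel \<Rightarrow> 'a set \<Rightarrow> (int \<Rightarrow> 'a set) \<Rightarrow> ('a \<Rightarrow> 'a \<Rightarrow>\<^sub>0 int) \<Rightarrow> ('a \<Rightarrow> 'a set \<Rightarrow>\<^sub>0 int) \<Rightarrow> bool" where
  "morse_model r Y E g h \<longleftrightarrow>
     (\<forall>p. \<forall>x\<in>E p. Poly_Mapping.keys (g x) \<subseteq> E (p - 1) \<and> frag_extend g (g x) = 0 \<and>
        h x \<in> poset_chains r Y p \<and> poset_boundary r (h x) = frag_extend h (g x)) \<and>
     (\<forall>p. \<forall>c\<in>poset_chains r Y p. poset_boundary r c = 0 \<longrightarrow>
        (\<exists>e u. Poly_Mapping.keys e \<subseteq> E p \<and> frag_extend g e = 0 \<and> u \<in> poset_chains r Y (p + 1) \<and>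
           c = frag_extend h e + poset_boundary r u)) \<and>
     (\<forall>p e. \<forall>u\<in>poset_chains r Y (p + 1). Poly_Mapping.keys e \<subseteq> E p \<longrightarrow> frag_extend g e = 0 \<longrightarrow>
        frag_extend h e = poset_boundary r u \<longrightarrow> (\<exists>b. Poly_Mapping.keys b \<subseteq> E (p + 1) \<and> e = frag_extend g b))"

lemma morse_model_chain_map:
  assumes "morse_model r Y E g h" "Poly_Mapping.keys e \<subseteq> E p"
  shows "Poly_Mapping.keys (frag_extend g e) \<subseteq> E (p - 1)" "frag_extend g (frag_extend g e) = 0"
    "frag_extend h e \<in> poset_chains r Y p" "poset_boundary r (frag_extend h e) = frag_extend h (frag_extend g e)"
proof -
  have gen: "Poly_Mapping.keys (g x) \<subseteq> E (p - 1)" "frag_extend g (g x) = 0"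
    "h x \<in> poset_chains r Y p" "poset_boundary r (h x) = frag_extend h (g x)" if "x \<in> E p" for x
    using assms(1) that by (auto simp: morse_model_def)
  show "Poly_Mapping.keys (frag_extend g e) \<subseteq> E (p - 1)"
    using assms(2) gen(1) by (rule frag_extend_mem_keys)
  show "frag_extend h e \<in> poset_chains r Y p"
    unfolding poset_chains_def mem_Collect_eq
    using assms(2) gen(3) by (intro frag_extend_mem_keys[of e "E p"]) (auto simp: poset_chains_def)
  show "frag_extend g (frag_extend g e) = 0"
    by (rule frag_additive_eqI[where g = "\<lambda>_. 0", OF assms(2)]) (simp_all add: frag_extend_diff gen)
  show "poset_boundary r (frag_extend h e) = frag_extend h (frag_extend g e)"
    by (rule frag_additive_eqI[OF assms(2)]) (simp_all add: frag_extend_diff poset_boundary_diff gen)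
qed

lemma morse_model_surj:
  assumes "morse_model r Y E g h" "c \<in> poset_chains r Y p" "poset_boundary r c = 0"
  obtains e u where "Poly_Mapping.keys e \<subseteq> E p" "frag_extend g e = 0" "u \<in> poset_chains r Y (p + 1)"
    "c = frag_extend h e + poset_boundary r u"
  using assms unfolding morse_model_def by blast

lemma morse_model_inj:
  assumes "morse_model r Y E g h" "u \<in> poset_chains r Y (p + 1)" "Poly_Mapping.keys e \<subseteq> E p"
    "frag_extend g e = 0" "frag_extend h e = poset_boundary r u"
  obtains b where "Poly_Mapping.keys b \<subseteq> E (p + 1)" "e = frag_extend g b"
  using assms unfolding morse_model_def by blast

context finite_poset begin

lemma morse_model_empty: "morse_model r {} (\<lambda>_. {}) g h"
proof -
  have "order_complex r {} = {}"
    by (auto simp: order_complex_def)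
  then have "poset_chains r {} p = {0}" for p
    by (auto simp: poset_chains_def)
  then show ?thesis
    by (simp add: morse_model_def)
qed

text \<open>The assumption \<open>rel\<close> says that the relative homology of \<open>Y\<close>
  and \<open>Z\<close> vanishes, so the same generators serve. It is used for cycles of
  \<open>Y\<close> and, one dimension up, for chains of \<open>Y\<close> whose boundary lies in
  \<open>Z\<close>.\<close>

lemma morse_model_collapse:
  assumes model: "morse_model r Z E g h" and ZY: "Z \<subseteq> Y"
    and rel: "\<And>q c. c \<in> poset_chains r Y q \<Longrightarrow> poset_boundary r c \<in> poset_chains r Z (q - 1) \<Longrightarrow>
      \<exists>u\<in>poset_chains r Y (q + 1). c - poset_boundary r u \<in> poset_chains r Z q"
  shows "morse_model r Y E g h"
  unfolding morse_model_def
proof (intro conjI allI ballI impI)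
  have sub: "poset_chains r Z q \<subseteq> poset_chains r Y q" for q
    using ZY by (rule poset_chains_mono)
  fix p x assume x: "x \<in> E p"
  then show "Poly_Mapping.keys (g x) \<subseteq> E (p - 1)" "frag_extend g (g x) = 0"
    "poset_boundary r (h x) = frag_extend h (g x)"
    using model by (auto simp: morse_model_def)
  show "h x \<in> poset_chains r Y p"
    using model x sub by (auto simp: morse_model_def)
next
  fix p c assume c: "c \<in> poset_chains r Y p" "poset_boundary r c = 0"
  have "poset_boundary r c \<in> poset_chains r Z (p - 1)"
    using c(2) poset_chains_closed(1) by simp
  then obtain u where u: "u \<in> poset_chains r Y (p + 1)" "c - poset_boundary r u \<in> poset_chains r Z p"
    using rel c(1) by blast
  have "poset_boundary r (c - poset_boundary r u) = 0"
    using c(2) poset_boundary_poset_boundary[OF u(1)] by (simp add: poset_boundary_diff)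
  from morse_model_surj[OF model u(2) this] obtain e v where
    ev: "Poly_Mapping.keys e \<subseteq> E p" "frag_extend g e = 0" "v \<in> poset_chains r Z (p + 1)"
      "c - poset_boundary r u = frag_extend h e + poset_boundary r v" .
  have "v \<in> poset_chains r Y (p + 1)"
    using ev(3) poset_chains_mono[OF ZY] by blast
  then have "u + v \<in> poset_chains r Y (p + 1)"
    using u(1) by (intro poset_chains_closed)
  moreover have "c = frag_extend h e + poset_boundary r (u + v)"
    using ev(4) by (simp add: poset_boundary_add algebra_simps)
  ultimately show "\<exists>e u. Poly_Mapping.keys e \<subseteq> E p \<and> frag_extend g e = 0 \<and> u \<in> poset_chains r Y (p + 1) \<and>
      c = frag_extend h e + poset_boundary r u"
    using ev(1,2) by blast
next
  fix p e u assume u: "u \<in> poset_chains r Y (p + 1)" and e: "Poly_Mapping.keys e \<subseteq> E p" "frag_extend g e = 0"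
    "frag_extend h e = poset_boundary r u"
  have "poset_boundary r u \<in> poset_chains r Z (p + 1 - 1)"
    using morse_model_chain_map(3)[OF model e(1)] e(3) by simp
  then obtain v where v: "v \<in> poset_chains r Y (p + 1 + 1)" "u - poset_boundary r v \<in> poset_chains r Z (p + 1)"
    using rel u by blast
  have "frag_extend h e = poset_boundary r (u - poset_boundary r v)"
    using e(3) poset_boundary_poset_boundary[OF v(1)] by (simp add: poset_boundary_diff)
  from morse_model_inj[OF model v(2) e(1,2) this] show "\<exists>b. Poly_Mapping.keys b \<subseteq> E (p + 1) \<and> e = frag_extend g b"
    by blast
qed

text \<open>The assumptions \<open>rel\<close> and \<open>free\<close> say that the relative
  homology is infinite cyclic, generated by \<open>z\<close>. The boundary of \<open>z\<close> is a
  cycle of \<open>Z\<close>, so the old model represents it by a cycle \<open>a\<close> up to the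
  boundary of some \<open>y\<close>. Correcting \<open>z\<close> to \<open>w = z - y\<close> makes
  the boundary exactly the image of \<open>a\<close>; hence \<open>x\<close> is sent to
  \<open>w\<close> and its differential is \<open>a\<close>.\<close>

lemma morse_model_attach_cell:
  assumes model: "morse_model r Z E g h" and ZY: "Z \<subseteq> Y" and x: "\<And>q. x \<notin> E q"
    and z: "z \<in> poset_chains r Y p" "poset_boundary r z \<in> poset_chains r Z (p - 1)"
    and rel: "\<And>q c. c \<in> poset_chains r Y q \<Longrightarrow> poset_boundary r c \<in> poset_chains r Z (q - 1) \<Longrightarrow>
       \<exists>n. \<exists>u\<in>poset_chains r Y (q + 1). c - frag_cmul n z - poset_boundary r u \<in> poset_chains r Z q
         \<and> (q \<noteq> p \<longrightarrow> n = 0)"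
    and free: "\<And>n u. u \<in> poset_chains r Y (p + 1) \<Longrightarrow>
       frag_cmul n z - poset_boundary r u \<in> poset_chains r Z p \<Longrightarrow> n = 0"
  obtains g' h' where "morse_model r Y (\<lambda>q. if q = p then insert x (E q) else E q) g' h'"
proof -
  let ?E = "\<lambda>q. if q = p then insert x (E q) else E q"
  have sub: "c \<in> poset_chains r Y q" if "c \<in> poset_chains r Z q" for c q
    using poset_chains_mono[OF ZY] that by blast
  have "poset_boundary r (poset_boundary r z) = 0"
    by (rule poset_boundary_poset_boundary[OF z(1)])
  from morse_model_surj[OF model z(2) this] obtain a y where
    a: "Poly_Mapping.keys a \<subseteq> E (p - 1)" "frag_extend g a = 0" "y \<in> poset_chains r Z (p - 1 + 1)"
      "poset_boundary r z = frag_extend h a + poset_boundary r y" .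
  define w where "w = z - y"
  have y: "y \<in> poset_chains r Z p"
    using a(3) by simp
  have w: "w \<in> poset_chains r Y p" "poset_boundary r w = frag_extend h a"
    using z(1) sub[OF y] a(4) by (auto simp: w_def poset_boundary_diff poset_chains_closed)
  \<comment> \<open>\<open>w\<close> differs from \<open>z\<close> by a chain of \<open>Z\<close>
    and represents the same relative class, so \<open>rel\<close> and \<open>free\<close> hold for
    it as well.\<close>
  have relw: "\<exists>n. \<exists>u\<in>poset_chains r Y (q + 1). \<exists>c'\<in>poset_chains r Z q.
      c = frag_cmul n w + poset_boundary r u + c' \<and> (q \<noteq> p \<longrightarrow> n = 0)"
    if c: "c \<in> poset_chains r Y q" "poset_boundary r c \<in> poset_chains r Z (q - 1)" for c q
  proof -
    obtain n u where u: "u \<in> poset_chains r Y (q + 1)"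
      "c - frag_cmul n z - poset_boundary r u \<in> poset_chains r Z q" "q \<noteq> p \<longrightarrow> n = 0"
      using rel[OF c] by blast
    let ?c' = "c - frag_cmul n z - poset_boundary r u + frag_cmul n y"
    have "frag_cmul n y \<in> poset_chains r Z q"
    proof (cases "q = p")
      case True
      then show ?thesis
        using y by (simp add: poset_chains_closed)
    qed (use u(3) in \<open>simp add: poset_chains_closed(1)\<close>)
    then have "?c' \<in> poset_chains r Z q"
      using u(2) by (intro poset_chains_closed(4))
    moreover have "c = frag_cmul n w + poset_boundary r u + ?c'"
      by (simp add: w_def frag_cmul_diff)
    ultimately show ?thesis
      using u(1,3) by blast
  qed
  have freew: "n = 0" if "u \<in> poset_chains r Y (p + 1)" "frag_cmul n w - poset_boundary r u \<in> poset_chains r Z p" for n u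
  proof (rule free[OF that(1)])
    have "frag_cmul n z - poset_boundary r u = (frag_cmul n w - poset_boundary r u) + frag_cmul n y"
      by (simp add: w_def frag_cmul_diff)
    also have "\<dots> \<in> poset_chains r Z p"
      using y by (intro poset_chains_closed(4,5) that(2))
    finally show "frag_cmul n z - poset_boundary r u \<in> poset_chains r Z p" .
  qed
  define g' where "g' = g(x := a)"
  define h' where "h' = h(x := w)"
  have upd: "frag_extend g' e = frag_extend g e" "frag_extend h' e = frag_extend h e"
    if "Poly_Mapping.keys e \<subseteq> E q" for e q
    using that x by (auto intro!: frag_extend_eq simp: g'_def h'_def)
  have updx: "g' x = a" "h' x = w"
    by (simp_all add: g'_def h'_def)
  have split: "\<exists>n e0. Poly_Mapping.keys e0 \<subseteq> E q \<and> e = frag_cmul n (frag_of x) + e0 \<and> (q \<noteq> p \<longrightarrow> n = 0)"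
    if e: "Poly_Mapping.keys e \<subseteq> ?E q" for e q
  proof (cases "q = p")
    case True
    let ?n = "Poly_Mapping.lookup e x"
    let ?e0 = "e - frag_cmul ?n (frag_of x)"
    have "Poly_Mapping.keys ?e0 \<subseteq> E q"
    proof
      fix y assume y: "y \<in> Poly_Mapping.keys ?e0"
      then have "y \<noteq> x"
        by (auto simp: in_keys_iff lookup_minus)
      then have "y \<in> Poly_Mapping.keys e"
        using y by (auto simp: in_keys_iff lookup_minus lookup_single)
      then show "y \<in> E q"
        using e True \<open>y \<noteq> x\<close> by auto
    qed
    then show ?thesis
      using True by (intro exI[of _ ?n] exI[of _ ?e0]) simp
  next
    case False
    then show ?thesis
      using e by (intro exI[of _ 0] exI[of _ e]) simp
  qed
  have sub': "Poly_Mapping.keys e \<subseteq> ?E q" if "Poly_Mapping.keys e \<subseteq> E q" for e q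
    using that by auto
  have "morse_model r Y ?E g' h'"
    unfolding morse_model_def
  proof (intro conjI allI ballI impI)
    fix q v assume v: "v \<in> ?E q"
    have *: "Poly_Mapping.keys (g' v) \<subseteq> E (q - 1) \<and> frag_extend g (g' v) = 0 \<and> h' v \<in> poset_chains r Y q \<and>
      poset_boundary r (h' v) = frag_extend h (g' v)"
    proof (cases "v = x")
      case True
      then have "q = p"
        using v x by (auto split: if_splits)
      then show ?thesis
        using True a w by (simp add: updx)
    next
      case False
      then have "v \<in> E q"
        using v by (auto split: if_splits)
      then show ?thesis
        using model False sub by (auto simp: morse_model_def g'_def h'_def)
    qed
    then show "Poly_Mapping.keys (g' v) \<subseteq> ?E (q - 1)" "frag_extend g' (g' v) = 0"
      "h' v \<in> poset_chains r Y q" "poset_boundary r (h' v) = frag_extend h' (g' v)"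
      using upd[of "g' v" "q - 1"] sub'[of "g' v" "q - 1"] by auto
  next
    fix q c assume c: "c \<in> poset_chains r Y q" "poset_boundary r c = 0"
    then have "poset_boundary r c \<in> poset_chains r Z (q - 1)"
      using poset_chains_closed(1) by simp
    from relw[OF c(1) this] obtain n u c' where
      u: "u \<in> poset_chains r Y (q + 1)" "c' \<in> poset_chains r Z q"
        "c = frag_cmul n w + poset_boundary r u + c'" "q \<noteq> p \<longrightarrow> n = 0"
      by blast
    \<comment> \<open>Thus \<open>n\<close> times the image of \<open>a\<close> bounds in
      \<open>Z\<close>, and by injectivity of the old model \<open>frag_cmul n a\<close> is
      \<open>frag_extend g b\<close> for some \<open>b\<close>. Adding
      \<open>frag_extend h b\<close> closes \<open>c'\<close> to a cycle of \<open>Z\<close>, to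
      which surjectivity applies.\<close>
    have bdc': "frag_cmul n (frag_extend h a) + poset_boundary r c' = 0"
      using c(2) poset_boundary_poset_boundary[OF u(1)]
      by (simp add: u(3) poset_boundary_add poset_boundary_cmul w(2))
    have key: "Poly_Mapping.keys (frag_cmul n a) \<subseteq> E (q - 1)"
      using a(1) keys_cmul[of n a] u(4) by (cases "q = p") auto
    have neg: "poset_boundary r (- c') = - poset_boundary r c'"
      using poset_boundary_cmul[of r "-1" c'] by simp
    have "frag_extend h (frag_cmul n a) = poset_boundary r (- c')"
      unfolding neg frag_extend_cmul eq_neg_iff_add_eq_0 by (rule bdc')
    moreover have "- c' \<in> poset_chains r Z (q - 1 + 1)"
      using u(2) by (simp add: poset_chains_closed(3))
    ultimately obtain b where b: "Poly_Mapping.keys b \<subseteq> E (q - 1 + 1)" "frag_cmul n a = frag_extend g b"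
      using morse_model_inj[OF model _ key] a(2) by (metis frag_cmul_zero2 frag_extend_cmul)
    then have bq: "Poly_Mapping.keys b \<subseteq> E q"
      by simp
    have "c' + frag_extend h b \<in> poset_chains r Z q"
      using u(2) morse_model_chain_map(3)[OF model bq] by (rule poset_chains_closed(4))
    moreover have "poset_boundary r (c' + frag_extend h b) = 0"
      unfolding poset_boundary_add morse_model_chain_map(4)[OF model bq] b(2)[symmetric] frag_extend_cmul
      using bdc' by (simp only: add.commute)
    ultimately obtain e v where
      ev: "Poly_Mapping.keys e \<subseteq> E q" "frag_extend g e = 0" "v \<in> poset_chains r Z (q + 1)"
        "c' + frag_extend h b = frag_extend h e + poset_boundary r v"
      by (rule morse_model_surj[OF model])
    \<comment> \<open>The summand \<open>- b\<close> takes back the correction of \<open>c'\<close>,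
      and its differential cancels the contribution \<open>n\<close> times \<open>a\<close> of the
      new generator.\<close>
    let ?e = "frag_cmul n (frag_of x) + (e - b)"
    have eb: "Poly_Mapping.keys (e - b) \<subseteq> E q"
      using ev(1) bq keys_diff[of e b] by blast
    have "Poly_Mapping.keys ?e \<subseteq> ?E q"
      using u(4) sub'[OF eb] keys_add[of "frag_cmul n (frag_of x)" "e - b"] keys_cmul_frag_of[of n x]
      by (cases "q = p") auto
    moreover have ext: "frag_extend g' (e - b) = - frag_cmul n a"
      "frag_extend h' (e - b) = frag_extend h e - frag_extend h b"
      unfolding upd[OF eb] b(2) by (simp_all add: ev(2) frag_extend_diff)
    then have "frag_extend g' ?e = 0"
      by (simp add: frag_extend_add frag_extend_cmul updx del: minus_frag_cmul)
    moreover have "u + v \<in> poset_chains r Y (q + 1)"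
      using u(1) sub[OF ev(3)] by (rule poset_chains_closed(4))
    moreover have "c' = frag_extend h e + poset_boundary r v - frag_extend h b"
      using ev(4) by (simp add: eq_diff_eq)
    then have "c = frag_extend h' ?e + poset_boundary r (u + v)"
      by (simp add: u(3) frag_extend_add frag_extend_cmul updx ext(2) poset_boundary_add)
    ultimately show "\<exists>e u. Poly_Mapping.keys e \<subseteq> ?E q \<and> frag_extend g' e = 0 \<and> u \<in> poset_chains r Y (q + 1) \<and>
        c = frag_extend h' e + poset_boundary r u"
      by blast
  next
    fix q e u assume u: "u \<in> poset_chains r Y (q + 1)" and e: "Poly_Mapping.keys e \<subseteq> ?E q" "frag_extend g' e = 0"
      "frag_extend h' e = poset_boundary r u"
    obtain n e0 where e0: "Poly_Mapping.keys e0 \<subseteq> E q" "e = frag_cmul n (frag_of x) + e0" "q \<noteq> p \<longrightarrow> n = 0"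
      using split[OF e(1)] by blast
    have he0: "frag_extend h e0 \<in> poset_chains r Z q"
      by (rule morse_model_chain_map(3)[OF model e0(1)])
    have hu: "frag_cmul n w + frag_extend h e0 = poset_boundary r u"
      using e(3) by (simp add: e0(2) frag_extend_add frag_extend_cmul updx upd[OF e0(1)])
    \<comment> \<open>If the new cell occurred in a cycle whose image bounds, a nonzero multiple of
      \<open>w\<close> would be a relative boundary.\<close>
    have n0: "n = 0"
    proof (cases "q = p")
      case True
      have "frag_cmul n w - poset_boundary r u = - frag_extend h e0"
        unfolding hu[symmetric] by simp
      also have "\<dots> \<in> poset_chains r Z p"
        using he0 True by (simp add: poset_chains_closed(3))
      finally show ?thesis
        using freew u True by blast
    qed (use e0(3) in simp)
    then have ee0: "e = e0" and hu0: "frag_extend h e0 = poset_boundary r u"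
      using e0(2) hu by simp_all
    have "poset_boundary r u \<in> poset_chains r Z (q + 1 - 1)"
      using he0 hu0 by simp
    \<comment> \<open>The bounding chain may contain the new cell \<open>m\<close> times when
      \<open>q + 1 = p\<close>, which contributes \<open>m\<close> times \<open>a\<close> to the
      cycle. The image of the rest \<open>e0 - frag_cmul m a\<close> bounds inside \<open>Z\<close>,
      where the old model applies.\<close>
    from relw[OF u this] obtain m v u' where
      v: "v \<in> poset_chains r Y (q + 1 + 1)" "u' \<in> poset_chains r Z (q + 1)"
        "u = frag_cmul m w + poset_boundary r v + u'" "q + 1 \<noteq> p \<longrightarrow> m = 0"
      by blast
    have eq: "frag_extend h e0 = frag_extend h (frag_cmul m a) + poset_boundary r u'"
      using poset_boundary_poset_boundary[OF v(1)]
      by (simp add: hu0 v(3) poset_boundary_add poset_boundary_cmul w(2) frag_extend_cmul)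
    have keya: "Poly_Mapping.keys (frag_cmul m a) \<subseteq> E q"
      using a(1) keys_cmul[of m a] v(4) by (cases "q + 1 = p") auto
    then have "Poly_Mapping.keys (e0 - frag_cmul m a) \<subseteq> E q"
      using e0(1) keys_diff[of e0 "frag_cmul m a"] by blast
    moreover have "frag_extend g (e0 - frag_cmul m a) = 0"
      using e(2) a(2) by (simp add: ee0 upd[OF e0(1)] frag_extend_diff frag_extend_cmul)
    moreover have "frag_extend h (e0 - frag_cmul m a) = poset_boundary r u'"
      by (simp add: frag_extend_diff eq)
    ultimately obtain b where b: "Poly_Mapping.keys b \<subseteq> E (q + 1)" "e0 - frag_cmul m a = frag_extend g b"
      by (rule morse_model_inj[OF model v(2)])
    let ?b = "frag_cmul m (frag_of x) + b"
    have "Poly_Mapping.keys ?b \<subseteq> ?E (q + 1)"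
      using v(4) sub'[OF b(1)] keys_add[of "frag_cmul m (frag_of x)" b] keys_cmul_frag_of[of m x]
      by (cases "q + 1 = p") auto
    moreover have "e = frag_extend g' ?b"
      unfolding frag_extend_add frag_extend_cmul frag_extend_of updx upd[OF b(1)] b(2)[symmetric]
      by (simp add: ee0)
    ultimately show "\<exists>b. Poly_Mapping.keys b \<subseteq> ?E (q + 1) \<and> e = frag_extend g' b"
      by blast
  qed
  then show thesis
    by (rule that)
qed

end

section \<open>Degrees and the induction over down-sets\<close>

context finite_poset begin

lemma finite_order_complex: "Y \<subseteq> X \<Longrightarrow> finite (order_complex r Y)"
  using finite_X by (auto simp: order_complex_def intro: finite_subset[of _ "Pow X"])

lemma under_subset: "under r x \<subseteq> X"
  using rel_in by (auto simp: under_def)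

lemma card_le_poset_degree:
  assumes "s \<in> order_complex r (under r x)"
  shows "card s \<le> poset_degree r x + 1"
proof -
  have "chain_length s \<le> poset_degree r x"
    unfolding poset_degree_def using finite_order_complex[OF under_subset] assms by (intro Max_ge) auto
  then show ?thesis
    by (simp add: chain_length_def)
qed

lemma poset_degree_attained:
  assumes "x \<in> X"
  obtains s where "s \<in> order_complex r (under r x)" "card s = poset_degree r x + 1"
    "maximal_chain r (under r x) s"
proof -
  have ne: "{x} \<in> order_complex r (under r x)"
    using refl[OF assms] by (auto simp: order_complex_def under_def Chains_def)
  have "poset_degree r x \<in> chain_length ` order_complex r (under r x)"
    unfolding poset_degree_def using finite_order_complex[OF under_subset] ne by (intro Max_in) auto
  then obtain s where s: "s \<in> order_complex r (under r x)" "poset_degree r x = chain_length s"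
    by blast
  then have "card s > 0"
    by (auto simp: order_complex_def card_gt_0_iff)
  then have card: "card s = poset_degree r x + 1"
    using s(2) by (simp add: chain_length_def)
  have "t = s" if "t \<in> order_complex r (under r x)" "s \<subseteq> t" for t
  proof -
    have "finite t"
      using that(1) by (simp add: order_complex_def)
    then show ?thesis
      using that(2) card_le_poset_degree[OF that(1)] card card_subset_eq[of t s] card_mono[of t s] by simp
  qed
  then have "maximal_chain r (under r x) s"
    using s(1) by (simp add: maximal_chain_def)
  then show thesis
    using that s(1) card by blast
qed

lemma insert_top_chain:
  assumes "(w, x) \<in> r" "s \<in> order_complex r (under r w)"
  shows "insert x s \<in> order_complex r (under r x)"
  using assms trans[of _ w x] refl[of x] rel_in[OF assms(1)]
  by (auto simp: order_complex_def under_def Chains_def)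

lemma poset_degree_less:
  assumes "w \<in> underS r x"
  shows "poset_degree r w < poset_degree r x"
proof -
  have wx: "(w, x) \<in> r" "w \<noteq> x" "w \<in> X"
    using assms rel_in by (auto simp: underS_def)
  obtain s where s: "s \<in> order_complex r (under r w)" "card s = poset_degree r w + 1"
    using poset_degree_attained[OF wx(3)] by blast
  have "x \<notin> s" "finite s"
    using s(1) wx antisym by (auto simp: order_complex_def under_def)
  then have "card (insert x s) = poset_degree r w + 2"
    using s(2) by simp
  then show ?thesis
    using card_le_poset_degree[OF insert_top_chain[OF wx(1) s(1)]] by simp
qed

text \<open>Homogeneity enters here: a longest chain below \<open>w\<close>, extended by
  \<open>x\<close>, is maximal in \<open>under r x\<close> because nothing lies strictly between, so
  it is as long as any other maximal chain there.\<close>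

lemma poset_degree_cover:
  assumes "homogeneous r (under r x)" "(w, x) \<in> hasse_diagram r"
  shows "poset_degree r x = poset_degree r w + 1"
proof -
  have wx: "(w, x) \<in> r" "w \<noteq> x" "w \<in> X" "x \<in> X"
    and cover: "\<And>z. w \<in> underS r z \<Longrightarrow> z \<in> underS r x \<Longrightarrow> False"
    using assms(2) rel_in by (auto simp: hasse_diagram_def underS_def)
  obtain s where s: "s \<in> order_complex r (under r w)" "card s = poset_degree r w + 1"
    "maximal_chain r (under r w) s"
    using poset_degree_attained[OF wx(3)] .
  \<comment> \<open>A longest chain contains \<open>w\<close>. So every member of a larger chain is
    comparable with \<open>w\<close>, and one not below \<open>w\<close> can only be
    \<open>x\<close>.\<close>
  have "insert w s \<in> order_complex r (under r w)"
    using s(1) refl[OF wx(3)] by (auto simp: order_complex_def under_def Chains_def)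
  then have ws: "w \<in> s"
    using s(3) by (auto simp: maximal_chain_def)
  have xs: "x \<notin> s" "finite s"
    using s(1) wx antisym by (auto simp: order_complex_def under_def)
  have max: "maximal_chain r (under r x) (insert x s)"
    unfolding maximal_chain_def
  proof (intro conjI ballI impI insert_top_chain[OF wx(1) s(1)])
    fix t assume t: "t \<in> order_complex r (under r x)" "insert x s \<subseteq> t"
    have "(z, w) \<in> r" if z: "z \<in> t - {x}" for z
    proof (rule ccontr)
      assume "(z, w) \<notin> r"
      then have "(w, z) \<in> r" "z \<noteq> w"
        using t z ws refl[OF wx(3)] by (auto simp: order_complex_def Chains_def)
      moreover have "(z, x) \<in> r"
        using t(1) z by (auto simp: order_complex_def under_def)
      ultimately show False
        using cover[of z] z by (auto simp: underS_def)
    qed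
    then have "t - {x} \<in> order_complex r (under r w)"
      using t ws wx(2) by (auto simp: order_complex_def under_def Chains_def)
    moreover have "s \<subseteq> t - {x}"
      using t(2) xs(1) by auto
    ultimately have "t - {x} = s"
      using s(3) by (simp add: maximal_chain_def)
    then show "t = insert x s"
      using t(2) by auto
  qed
  obtain t where t: "card t = poset_degree r x + 1" "maximal_chain r (under r x) t"
    using poset_degree_attained[OF wx(4)] by metis
  have "chain_length t = chain_length (insert x s)"
    using assms(1) t(2) max unfolding homogeneous_def by blast
  then show ?thesis
    using t(1) s(2) xs by (simp add: chain_length_def)
qed

end

lemma cellular_poset_imp_finite_poset: "cellular_poset X r \<Longrightarrow> finite_poset X r"
  by (simp add: cellular_poset_def graded_poset_def finite_poset_def)

text \<open>Closure under \<open>M\<close> makes the points of \<open>Y\<close> outside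
  \<open>Field M\<close> the critical points of \<open>Y\<close> itself, and closure downwards keeps
  the full strict down-sets, so the local assumptions on \<open>X\<close> remain available. Both
  must survive each removal, which is why a matched pair leaves at once.\<close>

lemma morse_matching_model:
  assumes cellular: "cellular_poset X r" and morse: "morse_matching r M"
    and adm: "homologically_admissible r M"
    and Y: "Y \<subseteq> X" "\<And>y. y \<in> Y \<Longrightarrow> underS r y \<subseteq> Y" "\<And>w x. (w, x) \<in> M \<Longrightarrow> w \<in> Y \<longleftrightarrow> x \<in> Y"
  shows "\<exists>g h. morse_model r Y (\<lambda>p. {x \<in> Y - Field M. int (poset_degree r x) = p}) g h"
  using Y
proof (induction "card Y" arbitrary: Y rule: less_induct)
  case less
  interpret finite_poset X r
    using cellular by (rule cellular_poset_imp_finite_poset)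
  let ?E = "\<lambda>Y p. {x \<in> Y - Field M. int (poset_degree r x) = p}"
  have finY: "finite Y"
    using less.prems(1) finite_X finite_subset by blast
  have hm: "hasse_matching r M"
    using morse by (simp only: morse_matching_def)
  then have M: "M \<subseteq> hasse_diagram r"
    by (simp only: hasse_matching_def)
  have disjoint: "{w, x} \<inter> {w', x'} = {}" if wx: "(w, x) \<in> M" "(w', x') \<in> M" "(w, x) \<noteq> (w', x')" for w x w' x'
  proof -
    from bspec[OF conjunct2[OF hm[unfolded hasse_matching_def]] wx(1)]
    have "\<forall>(w', x')\<in>M. (w, x) \<noteq> (w', x') \<longrightarrow> {w, x} \<inter> {w', x'} = {}"
      unfolding prod.case .
    from bspec[OF this wx(2)] have "(w, x) \<noteq> (w', x') \<longrightarrow> {w, x} \<inter> {w', x'} = {}"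
      unfolding prod.case .
    then show ?thesis
      using wx(3) by (rule mp)
  qed
  have cover: "poset_degree r x = poset_degree r w + 1" if "(w, x) \<in> hasse_diagram r" for w x
    using that cellular rel_in poset_degree_cover
    by (fastforce simp: cellular_poset_def graded_poset_def hasse_diagram_def underS_def)
  show ?case
  proof (cases "Y = {}")
    case True
    then show ?thesis
      using morse_model_empty by auto
  next
    case False
    define n where "n = Max (poset_degree r ` Y)"
    have le_n: "poset_degree r y \<le> n" if "y \<in> Y" for y
      unfolding n_def using that finY by simp
    \<comment> \<open>Degree increases strictly along the order, so a point of top degree is maximal
      in \<open>Y\<close> and is available as an apex.\<close>
    have max_n: "z = y" if "y \<in> Y" "poset_degree r y = n" "z \<in> Y" "(y, z) \<in> r" for y z
      using poset_degree_less[of y z] le_n[OF that(3)] that by (auto simp: underS_def)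
    define T where "T = {y \<in> Y. poset_degree r y = n}"
    have "n \<in> poset_degree r ` Y"
      unfolding n_def using finY False by (intro Max_in) auto
    then have "T \<noteq> {}"
      by (auto simp: T_def)
    show ?thesis
    proof (cases "T \<subseteq> Field M")
      case False
      then obtain x where x: "x \<in> Y" "poset_degree r x = n" "x \<notin> Field M"
        by (auto simp: T_def)
      let ?Z = "Y - {x}"
      have "card ?Z < card Y"
        using finY x(1) by (rule card_Diff1_less)
      moreover have "underS r y \<subseteq> ?Z" if "y \<in> ?Z" for y
        using less.prems(2)[of y] that max_n[OF x(1,2), of y] by (auto simp: underS_def)
      moreover have "w \<in> ?Z \<longleftrightarrow> v \<in> ?Z" if "(w, v) \<in> M" for w v
        using less.prems(3)[OF that] that x(3) by (auto simp: Field_def)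
      ultimately obtain g h where gh: "morse_model r ?Z (?E ?Z) g h"
        using less.hyps[of ?Z] less.prems(1) by blast
      have xX: "x \<in> X"
        using x(1) less.prems(1) by blast
      have "homology_sphere r (underS r x) (int n - 1)"
        using cellular xX x(2) by (auto simp: cellular_poset_def)
      from relative_sphere[OF xX x(1) max_n[OF x(1,2)] less.prems(2)[OF x(1)] this]
      obtain z where z: "z \<in> poset_chains r Y (int n)" "poset_boundary r z \<in> poset_chains r ?Z (int n - 1)"
        "\<And>q c. c \<in> poset_chains r Y q \<Longrightarrow> poset_boundary r c \<in> poset_chains r ?Z (q - 1) \<Longrightarrow>
           \<exists>m. \<exists>u\<in>poset_chains r Y (q + 1). c - frag_cmul m z - poset_boundary r u \<in> poset_chains r ?Z q
             \<and> (q \<noteq> int n \<longrightarrow> m = 0)"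
        "\<And>m u. u \<in> poset_chains r Y (int n + 1) \<Longrightarrow>
           frag_cmul m z - poset_boundary r u \<in> poset_chains r ?Z (int n) \<Longrightarrow> m = 0"
        by blast
      obtain g' h' where "morse_model r Y (\<lambda>q. if q = int n then insert x (?E ?Z q) else ?E ?Z q) g' h'"
        by (rule morse_model_attach_cell[OF gh _ _ z]) auto
      moreover have "(\<lambda>q. if q = int n then insert x (?E ?Z q) else ?E ?Z q) = ?E Y"
        using x by (intro ext) auto
      ultimately show ?thesis
        by auto
    next
      case True
      have acyc: "acyclic (matching_digraph r M)"
        using morse by (simp add: morse_matching_def)
      have "matching_digraph r M \<subseteq> X \<times> X"
        using rel_in by (auto simp: matching_digraph_def hasse_diagram_def underS_def)
      then have "finite (matching_digraph r M)"
        using finite_X finite_subset by blast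
      \<comment> \<open>Edges join different degrees, so points of \<open>T\<close> are related only
        by longer paths; minimality is taken for the transitive closure.\<close>
      then have "wf ((matching_digraph r M)\<^sup>+)"
        using acyc by (intro wf_trancl finite_acyclic_wf)
      then obtain x where x: "x \<in> T" "\<And>y. (y, x) \<in> (matching_digraph r M)\<^sup>+ \<Longrightarrow> y \<notin> T"
        using \<open>T \<noteq> {}\<close> by (metis all_not_in_conv wfE_min)
      have xY: "x \<in> Y" "poset_degree r x = n"
        using x(1) by (auto simp: T_def)
      \<comment> \<open>A partner above \<open>x\<close> would lie in \<open>Y\<close> and have
        degree \<open>n + 1\<close>, so \<open>x\<close> is matched downwards.\<close>
      obtain w where w: "(w, x) \<in> M"
      proof -
        have "(x, v) \<notin> M" for v
          using cover[of x v] M less.prems(3)[of x v] le_n[of v] xY by auto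
        then show thesis
          using x(1) True that by (auto simp: Field_def)
      qed
      have wx: "w \<in> underS r x" "w \<in> Y" "(w, x) \<in> hasse_diagram r"
        using w M less.prems(3)[OF w] xY(1) by (auto simp: hasse_diagram_def)
      have degw: "n = poset_degree r w + 1"
        using cover[OF wx(3)] xY(2) by simp
      \<comment> \<open>Since \<open>w\<close> has degree \<open>n - 1\<close>, another point
        \<open>y\<close> above it has degree \<open>n\<close> and covers it by an unmatched edge.
        That edge is reversed, so the path from \<open>y\<close> over \<open>w\<close> to
        \<open>x\<close> contradicts minimality of \<open>x\<close>.\<close>
      have wmax: "y = w \<or> y = x" if y: "y \<in> Y" "(w, y) \<in> r" for y
      proof (rule ccontr)
        assume ne: "\<not> (y = w \<or> y = x)"
        then have wy: "w \<in> underS r y"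
          using y(2) by (auto simp: underS_def)
        then have degy: "poset_degree r y = n"
          using poset_degree_less[OF wy] le_n[OF y(1)] degw by simp
        have "\<not> (w \<in> underS r z \<and> z \<in> underS r y)" for z
          using poset_degree_less[of w z] poset_degree_less[of z y] degy degw by auto
        then have "(w, y) \<in> hasse_diagram r"
          using wy by (auto simp: hasse_diagram_def)
        moreover have "(w, y) \<notin> M"
          using disjoint[OF w, of w y] ne by auto
        ultimately have "(y, w) \<in> matching_digraph r M"
          by (auto simp: matching_digraph_def)
        moreover have "(w, x) \<in> matching_digraph r M"
          using w wx(3) by (auto simp: matching_digraph_def)
        ultimately have "(y, x) \<in> (matching_digraph r M)\<^sup>+"
          by (meson r_into_trancl' trancl_into_trancl)
        then show False
          using x(2)[of y] y(1) degy by (simp add: T_def)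
      qed
      let ?Z = "Y - {w, x}"
      have "card ?Z < card Y"
        using finY xY(1) by (intro psubset_card_mono) auto
      moreover have "underS r y \<subseteq> ?Z" if y: "y \<in> ?Z" for y
        using less.prems(2)[of y] y wmax[of y] max_n[OF xY, of y] by (auto simp: underS_def)
      moreover have "u \<in> ?Z \<longleftrightarrow> v \<in> ?Z" if "(u, v) \<in> M" for u v
        using less.prems(3)[OF that] disjoint[OF w that] by auto
      ultimately obtain g h where gh: "morse_model r ?Z (?E ?Z) g h"
        using less.hyps[of ?Z] less.prems(1) by blast
      have "acyclic_poset r (underS r x - {w})"
        using adm w by (auto simp: homologically_admissible_def)
      from relative_pair[OF _ xY(1) max_n[OF xY] less.prems(2)[OF xY(1)] wx(1) wmax less.prems(2)[OF wx(2)] this]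
      have "morse_model r Y (?E ?Z) g h"
        using xY(1) less.prems(1) by (intro morse_model_collapse[OF gh]) auto
      moreover have "?E ?Z = ?E Y"
        using w by (intro ext) (auto simp: Field_def)
      ultimately show ?thesis
        by auto
    qed
  qed
qed

section \<open>Homology and ranks of a model\<close>

lemma morse_model_chain_complex:
  assumes "morse_model r Y E g h"
  shows "chain_complex (\<lambda>p. free_Abelian_group (E p)) (\<lambda>_. frag_extend g)"
  unfolding chain_complex_def
proof (intro conjI allI ballI)
  show "comm_group (free_Abelian_group (E p))" for p
    by (rule abelian_free_Abelian_group)
  show "frag_extend g \<in> hom (free_Abelian_group (E p)) (free_Abelian_group (E (p - 1)))" for p
    using morse_model_chain_map(1)[OF assms] by (intro homI) (auto simp: frag_extend_add)
  show "frag_extend g (frag_extend g c) = \<one>\<^bsub>free_Abelian_group (E (p - 2))\<^esub>"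
    if "c \<in> carrier (free_Abelian_group (E p))" for p c
    using morse_model_chain_map(2)[OF assms, of c p] that by simp
qed

context finite_poset begin

context
  fixes Y E g h
  assumes model: "morse_model r Y E g h"
begin

lemma morse_model_homology:
  "chain_homology (\<lambda>p. free_Abelian_group (E p)) (\<lambda>_. frag_extend g) p
    = frag_group {e. Poly_Mapping.keys e \<subseteq> E p \<and> frag_extend g e = 0}
        Mod frag_extend g ` {e. Poly_Mapping.keys e \<subseteq> E (p + 1)}"
  by (rule chain_homology_free_Abelian_group) (simp_all add: frag_extend_diff morse_model_chain_map(1)[OF model])

lemma frag_subgroup_morse_cycles: "frag_subgroup {e. Poly_Mapping.keys e \<subseteq> E p \<and> frag_extend g e = 0}"
  using frag_subgroupD(1,2)[OF frag_subgroup_keys[of "E p"]]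
  by (simp add: frag_subgroup_def frag_extend_diff)

lemma frag_subgroup_morse_boundaries: "frag_subgroup (frag_extend g ` {e. Poly_Mapping.keys e \<subseteq> E p})"
  by (rule frag_subgroup_image[OF frag_subgroup_keys]) (rule frag_extend_diff)

lemma morse_boundaries_subset_cycles:
  "frag_extend g ` {e. Poly_Mapping.keys e \<subseteq> E (p + 1)} \<subseteq> {e. Poly_Mapping.keys e \<subseteq> E p \<and> frag_extend g e = 0}"
  using morse_model_chain_map(1,2)[OF model, of _ "p + 1"] by auto

lemma poset_boundaries_subset_cycles:
  "poset_boundary r ` poset_chains r Y (p + 1) \<subseteq> {c \<in> poset_chains r Y p. poset_boundary r c = 0}"
  using poset_boundary_closed[of _ r Y "p + 1"] poset_boundary_poset_boundary by auto

text \<open>Induced by \<open>frag_extend h\<close>; the last two clauses of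
  \<open>morse_model\<close> supply the two conditions of \<open>Mod_iso_Mod\<close>.\<close>

lemma morse_model_homology_iso:
  "chain_homology (\<lambda>p. free_Abelian_group (E p)) (\<lambda>_. frag_extend g) p \<cong> poset_homology r Y p"
  unfolding morse_model_homology poset_homology_eq
proof (rule Mod_iso_Mod[where f = "frag_extend h"])
  let ?D = "{e. Poly_Mapping.keys e \<subseteq> E p \<and> frag_extend g e = 0}"
  let ?C = "{c \<in> poset_chains r Y p. poset_boundary r c = 0}"
  show "comm_group (frag_group ?D)" "comm_group (frag_group ?C)"
    by (intro comm_group_frag_group frag_subgroup_morse_cycles frag_subgroup_poset_cycles)+
  show "subgroup (frag_extend g ` {e. Poly_Mapping.keys e \<subseteq> E (p + 1)}) (frag_group ?D)"
    by (subst subgroup_frag_group_iff[OF frag_subgroup_morse_cycles])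
       (intro conjI morse_boundaries_subset_cycles frag_subgroup_morse_boundaries)
  have "frag_subgroup (poset_boundary r ` poset_chains r Y (p + 1))"
    by (rule frag_subgroup_image[OF frag_subgroup_poset_chains poset_boundary_diff])
  then show "subgroup (poset_boundary r ` poset_chains r Y (p + 1)) (frag_group ?C)"
    by (subst subgroup_frag_group_iff[OF frag_subgroup_poset_cycles])
       (intro conjI poset_boundaries_subset_cycles)
  have hC: "frag_extend h e \<in> ?C" if "e \<in> ?D" for e
    using morse_model_chain_map(3,4)[OF model, of e p] that by simp
  then show "frag_extend h \<in> hom (frag_group ?D) (frag_group ?C)"
    by (intro homI) (simp_all only: frag_group_simps frag_extend_add)
  show "frag_extend h a \<in> poset_boundary r ` poset_chains r Y (p + 1)
      \<longleftrightarrow> a \<in> frag_extend g ` {e. Poly_Mapping.keys e \<subseteq> E (p + 1)}"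
    if "a \<in> carrier (frag_group ?D)" for a
  proof
    assume "frag_extend h a \<in> poset_boundary r ` poset_chains r Y (p + 1)"
    then obtain u where u: "frag_extend h a = poset_boundary r u" "u \<in> poset_chains r Y (p + 1)"
      by (rule imageE)
    have "Poly_Mapping.keys a \<subseteq> E p" "frag_extend g a = 0"
      using that by simp_all
    from morse_model_inj[OF model u(2) this u(1)] obtain b where
      "Poly_Mapping.keys b \<subseteq> E (p + 1)" "a = frag_extend g b" .
    then show "a \<in> frag_extend g ` {e. Poly_Mapping.keys e \<subseteq> E (p + 1)}"
      by simp
  next
    assume "a \<in> frag_extend g ` {e. Poly_Mapping.keys e \<subseteq> E (p + 1)}"
    then obtain e where e: "a = frag_extend g e" "Poly_Mapping.keys e \<subseteq> E (p + 1)"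
      by blast
    show "frag_extend h a \<in> poset_boundary r ` poset_chains r Y (p + 1)"
      unfolding e(1) morse_model_chain_map(4)[OF model e(2), symmetric]
      using morse_model_chain_map(3)[OF model e(2)] by (rule imageI)
  qed
  show "\<exists>a\<in>carrier (frag_group ?D). b \<otimes>\<^bsub>frag_group ?C\<^esub> inv\<^bsub>frag_group ?C\<^esub> frag_extend h a
      \<in> poset_boundary r ` poset_chains r Y (p + 1)"
    if "b \<in> carrier (frag_group ?C)" for b
  proof -
    have "b \<in> poset_chains r Y p" "poset_boundary r b = 0"
      using that by auto
    then obtain e u where e: "Poly_Mapping.keys e \<subseteq> E p" "frag_extend g e = 0"
      and u: "u \<in> poset_chains r Y (p + 1)" "b = frag_extend h e + poset_boundary r u"
      by (rule morse_model_surj[OF model])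
    have eD: "e \<in> ?D"
      using e by simp
    have "b \<otimes>\<^bsub>frag_group ?C\<^esub> inv\<^bsub>frag_group ?C\<^esub> frag_extend h e = poset_boundary r u"
      unfolding inv_frag_group[OF frag_subgroup_poset_cycles hC[OF eD]] u(2) by simp
    then show ?thesis
      using eD u(1) by (intro bexI[of _ e]) auto
  qed
qed

text \<open>The Betti number is the rank of the cycles minus that of the incoming boundaries, and
  the cycles have rank \<open>card (E p)\<close> minus that of the outgoing boundaries.\<close>

lemma morse_model_betti:
  assumes fin: "\<And>p. finite (E p)"
  shows "abelian_rank (poset_homology r Y p)
      + frag_dim (frag_extend g ` {e. Poly_Mapping.keys e \<subseteq> E p})
      + frag_dim (frag_extend g ` {e. Poly_Mapping.keys e \<subseteq> E (p + 1)}) = card (E p)"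
proof -
  let ?D = "{e. Poly_Mapping.keys e \<subseteq> E p \<and> frag_extend g e = 0}"
  let ?N = "frag_extend g ` {e. Poly_Mapping.keys e \<subseteq> E (p + 1)}"
  have sub: "subgroup ?N (frag_group ?D)"
    by (subst subgroup_frag_group_iff[OF frag_subgroup_morse_cycles])
       (intro conjI morse_boundaries_subset_cycles frag_subgroup_morse_boundaries)
  have sub': "subgroup (poset_boundary r ` poset_chains r Y (p + 1))
      (frag_group {c \<in> poset_chains r Y p. poset_boundary r c = 0})"
    by (subst subgroup_frag_group_iff[OF frag_subgroup_poset_cycles])
       (intro conjI poset_boundaries_subset_cycles frag_subgroup_image[OF frag_subgroup_poset_chains poset_boundary_diff])
  have "abelian_rank (frag_group ?D Mod ?N) = abelian_rank (poset_homology r Y p)"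
  proof (rule abelian_rank_iso)
    show "frag_group ?D Mod ?N \<cong> poset_homology r Y p"
      using morse_model_homology_iso[of p] unfolding morse_model_homology .
    show "comm_group (frag_group ?D Mod ?N)"
      by (rule comm_group.abelian_FactGroup[OF comm_group_frag_group[OF frag_subgroup_morse_cycles] sub])
    show "comm_group (poset_homology r Y p)"
      unfolding poset_homology_eq
      by (rule comm_group.abelian_FactGroup[OF comm_group_frag_group[OF frag_subgroup_poset_cycles] sub'])
  qed
  moreover have "abelian_rank (frag_group ?D Mod ?N) + frag_dim ?N = frag_dim ?D"
    by (rule abelian_rank_frag_group_Mod(2)[OF frag_subgroup_morse_boundaries frag_subgroup_morse_cycles
          morse_boundaries_subset_cycles _ fin[of p]]) auto
  moreover have "frag_dim {c \<in> {e. Poly_Mapping.keys e \<subseteq> E p}. frag_extend g c = 0}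
      + frag_dim (frag_extend g ` {e. Poly_Mapping.keys e \<subseteq> E p}) = card (E p)"
    unfolding frag_dim_keys[OF fin, symmetric]
    using morse_model_chain_map(1)[OF model, of _ p]
    by (intro frag_dim_kernel_image[OF frag_subgroup_keys order_refl fin frag_extend_diff _ fin[of "p - 1"]]) auto
  ultimately show ?thesis
    by simp
qed

end

end

section \<open>Alternating sums and the Morse inequalities\<close>

lemma alternating_sum_Suc:
  fixes f :: "nat \<Rightarrow> int"
  shows "(\<Sum>i\<le>Suc k. (-1) ^ (Suc k - i) * f i) = f (Suc k) - (\<Sum>i\<le>k. (-1) ^ (k - i) * f i)"
proof -
  have "(\<Sum>i\<le>k. (-1) ^ (Suc k - i) * f i) = (\<Sum>i\<le>k. - ((-1) ^ (k - i) * f i))"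
    by (intro sum.cong) (auto simp: Suc_diff_le)
  then show ?thesis
    by (simp add: sum_negf)
qed

text \<open>With \<open>\<beta> i\<close> the rank of the boundary leaving degree \<open>i\<close>,
  each intermediate rank occurs twice with opposite signs. Only the last one survives, and its
  nonnegativity is the strong inequality.\<close>

lemma alternating_sum_telescope:
  fixes m b \<beta> :: "nat \<Rightarrow> int"
  assumes "\<And>i. m i = b i + \<beta> i + \<beta> (Suc i)" "\<beta> 0 = 0"
  shows "(\<Sum>i\<le>k. (-1) ^ (k - i) * m i) = (\<Sum>i\<le>k. (-1) ^ (k - i) * b i) + \<beta> (Suc k)"
proof (induction k)
  case (Suc k)
  then show ?case
    unfolding alternating_sum_Suc by (simp add: assms(1))
qed (simp add: assms)

text \<open>Turns an Euler characteristic, up to the sign \<open>(-1) ^ N\<close>, into the sum of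
  the strong inequality for \<open>k = N\<close>.\<close>

lemma alternating_sum_support:
  fixes f :: "nat \<Rightarrow> nat"
  assumes "\<And>p. f p \<noteq> 0 \<Longrightarrow> p \<le> N"
  shows "(\<Sum>p | f p \<noteq> 0. (-1) ^ p * int (f p)) = (-1) ^ N * (\<Sum>p\<le>N. (-1) ^ (N - p) * int (f p))"
proof -
  have "(\<Sum>p | f p \<noteq> 0. (-1) ^ p * int (f p)) = (\<Sum>p\<le>N. (-1) ^ p * int (f p))"
    using assms by (intro sum.mono_neutral_left) auto
  also have "\<dots> = (\<Sum>p\<le>N. (-1) ^ N * ((-1) ^ (N - p) * int (f p)))"
  proof (intro sum.cong)
    fix p assume "p \<in> {..N}"
    then have "(-1 :: int) ^ N = (-1) ^ p * (-1) ^ (N - p)"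
      by (simp flip: power_add)
    moreover have "(-1 :: int) ^ (N - p) * (-1) ^ (N - p) = 1"
      by (simp flip: power_mult_distrib)
    ultimately show "(-1) ^ p * int (f p) = (-1) ^ N * ((-1) ^ (N - p) * int (f p))"
      by (simp add: mult.assoc)
  qed simp
  finally show ?thesis
    by (simp add: sum_distrib_left)
qed

theorem corollary3p15:
  fixes X :: "'a set" and r M :: "'a rel"
  assumes "cellular_poset X r"
    and "morse_matching r M"
    and "homologically_admissible r M"
  shows "(\<exists>d. chain_complex (morse_chain_group X r M) d \<and>
            (\<forall>p\<ge>0. chain_homology (morse_chain_group X r M) d p \<cong> poset_homology r X p)) \<and>
         (\<forall>k. (\<Sum>i\<le>k. (-1) ^ (k - i) * int (num_critical X r M i))
              \<ge> (\<Sum>i\<le>k. (-1) ^ (k - i) * int (poset_betti X r i))) \<and>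
         (\<forall>p. num_critical X r M p \<ge> poset_betti X r p) \<and>
         finite {p. num_critical X r M p \<noteq> 0} \<and> finite {p. poset_betti X r p \<noteq> 0} \<and>
         (\<Sum>p | num_critical X r M p \<noteq> 0. (-1) ^ p * int (num_critical X r M p))
           = (\<Sum>p | poset_betti X r p \<noteq> 0. (-1) ^ p * int (poset_betti X r p))"
proof -
  interpret finite_poset X r
    using assms(1) by (rule cellular_poset_imp_finite_poset)
  define E where "E = critical_points_of_degree X r M"
  have E: "E = (\<lambda>p. {x \<in> X - Field M. int (poset_degree r x) = p})"
    by (intro ext) (simp add: E_def critical_points_of_degree_def critical_points_def)
  have "M \<subseteq> X \<times> X"
    using assms(2) rel_in
    by (fastforce simp: morse_matching_def hasse_matching_def hasse_diagram_def underS_def)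
  then have "\<exists>g h. morse_model r X E g h"
    unfolding E using underS_subset by (intro morse_matching_model[OF assms]) auto
  then obtain g h where model: "morse_model r X E g h"
    by blast
  have group: "morse_chain_group X r M = (\<lambda>p. free_Abelian_group (E p))"
    by (intro ext) (simp add: morse_chain_group_def E_def)
  have finE: "finite (E p)" for p
    using finite_X by (simp add: E)
  define \<beta> where "\<beta> p = frag_dim (frag_extend g ` {e. Poly_Mapping.keys e \<subseteq> E (int p)})" for p
  have betti: "num_critical X r M p = poset_betti X r p + \<beta> p + \<beta> (Suc p)" for p
    using morse_model_betti[OF model finE, of "int p"]
    by (simp add: num_critical_def poset_betti_def \<beta>_def E_def add.commute)
  \<comment> \<open>Degrees are natural numbers, so there is no generator in degree -1 and nothing
    leaves degree 0.\<close>
  have "frag_extend g ` {e. Poly_Mapping.keys e \<subseteq> E 0} \<subseteq> {0}"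
    using morse_model_chain_map(1)[OF model, of _ 0] by (auto simp: E)
  moreover have "0 \<in> frag_extend g ` {e. Poly_Mapping.keys e \<subseteq> E 0}"
    by (rule image_eqI[of _ _ 0]) simp_all
  ultimately have "frag_extend g ` {e. Poly_Mapping.keys e \<subseteq> E 0} = {0}"
    by auto
  then have \<beta>0: "\<beta> 0 = 0"
    by (simp add: \<beta>_def)
  have sums: "(\<Sum>i\<le>k. (-1) ^ (k - i) * int (num_critical X r M i))
      = (\<Sum>i\<le>k. (-1) ^ (k - i) * int (poset_betti X r i)) + int (\<beta> (Suc k))" for k
    by (rule alternating_sum_telescope) (simp_all add: betti \<beta>0)
  define N where "N = Max (poset_degree r ` X)"
  have N: "p \<le> N" if "num_critical X r M p \<noteq> 0" for p
  proof -
    have "E (int p) \<noteq> {}"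
      using that by (auto simp: num_critical_def E_def)
    then obtain x where "x \<in> X" "poset_degree r x = p"
      by (auto simp: E)
    then show ?thesis
      unfolding N_def using finite_X by (intro Max_ge) auto
  qed
  have N': "p \<le> N" if "poset_betti X r p \<noteq> 0" for p
    using that betti[of p] by (intro N) simp
  \<comment> \<open>No critical point has degree \<open>Suc N\<close>, so by \<open>betti\<close>
    the error term of \<open>sums\<close> vanishes at \<open>N\<close>: the inequality is an
    equality there, which gives the Euler characteristic.\<close>
  have "\<beta> (Suc N) = 0"
    using betti[of "Suc N"] N[of "Suc N"] by fastforce
  then have "(\<Sum>p | num_critical X r M p \<noteq> 0. (-1) ^ p * int (num_critical X r M p))
      = (\<Sum>p | poset_betti X r p \<noteq> 0. (-1) ^ p * int (poset_betti X r p))"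
    using alternating_sum_support[of "num_critical X r M", OF N]
      alternating_sum_support[of "poset_betti X r", OF N'] sums[of N] by simp
  moreover have "finite {p. num_critical X r M p \<noteq> 0}" "finite {p. poset_betti X r p \<noteq> 0}"
    using N N' by (auto intro: finite_subset[of _ "{..N}"])
  moreover have "chain_complex (morse_chain_group X r M) (\<lambda>_. frag_extend g)"
    "\<forall>p\<ge>0. chain_homology (morse_chain_group X r M) (\<lambda>_. frag_extend g) p \<cong> poset_homology r X p"
    unfolding group using morse_model_chain_complex[OF model] morse_model_homology_iso[OF model] by auto
  ultimately show ?thesis
    using betti sums by auto
qed

end
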